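(* Let $X$ be an algebraic variety over a field $F$ equipped with an absolute value, let $\mathscr I\subset\mathscr O_X$ be a sheaf of ideals on $X$, and let $\pi\colon Y\to X$ be the blow-up of $\mathscr I$, with exceptional Cartier divisor $D$ (the inverse image of $V(\mathscr I)$) and canonical section $\mathsf s_D$ of $\mathscr O_Y(D)$. Let $\mathscr E$ be a locally free sheaf of finite rank on $X$ with a section $\sigma_Z\in\Gamma(X,\mathscr E)$ whose scheme of zeroes equals $V(\mathscr I)$ as schemes. Assume $\mathscr E$ is given a metric. Then the line sheaf $\mathscr O_Y(D)$ has a canonical metric (determined by the metric of $\mathscr E$) such that for every point $y$ of $Y$, $$\|\mathsf s_D\|(y)=\|\sigma_Z\|(\pi(y)).$$
   Context: A metric on a locally free sheaf $\mathscr E$ on $X$ is a family of norms on the fibres $\mathscr E_x$, $x\in X(\bar F)$, depending continuously on $x$ (with respect to an extension of the absolute value to $\bar F$). The canonical section $\mathsf s_D$ is the dual of the pull-back of the inclusion $\mathscr I\to\mathscr O_X$, using $\mathscr O_Y(-D)=\mathscr I\cdot\mathscr O_Y$. *)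

theory Defs
  imports "HOL-Analysis.Analysis" "HOL-Algebra.Algebra" "HOL-Algebra.Algebraic_Closure_Type"
    "HOL-Library.Poly_Mapping"
begin

section \<open>Ringed spaces and schemes\<close>

definition sheaf_of_sets ::
  "'p topology \<Rightarrow> ('p set \<Rightarrow> 'a set) \<Rightarrow> ('p set \<Rightarrow> 'p set \<Rightarrow> 'a \<Rightarrow> 'a) \<Rightarrow> bool" where
  "sheaf_of_sets T S r \<longleftrightarrow>
    (\<forall>U V. openin T U \<and> openin T V \<and> V \<subseteq> U \<longrightarrow> r U V \<in> S U \<rightarrow> S V) \<and>
    (\<forall>U. openin T U \<longrightarrow> (\<forall>s\<in>S U. r U U s = s)) \<and>
    (\<forall>U V W. openin T U \<and> openin T V \<and> openin T W \<and> W \<subseteq> V \<and> V \<subseteq> U \<longrightarrow>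
      (\<forall>s\<in>S U. r V W (r U V s) = r U W s)) \<and>
    (\<forall>\<U> s. (\<forall>U\<in>\<U>. openin T U \<and> s U \<in> S U) \<and>
      (\<forall>U\<in>\<U>. \<forall>V\<in>\<U>. r U (U \<inter> V) (s U) = r V (U \<inter> V) (s V)) \<longrightarrow>
      (\<exists>!t. t \<in> S (\<Union>\<U>) \<and> (\<forall>U\<in>\<U>. r (\<Union>\<U>) U t = s U)))"

record ('p, 'a) ringed_space =
  top_of :: "'p topology"
  sec :: "'p set \<Rightarrow> 'a ring"
  res :: "'p set \<Rightarrow> 'p set \<Rightarrow> 'a \<Rightarrow> 'a"

abbreviation pts :: "('p, 'a) ringed_space \<Rightarrow> 'p set" where
  "pts \<XX> \<equiv> topspace (top_of \<XX>)"

abbreviation is_open :: "('p, 'a) ringed_space \<Rightarrow> 'p set \<Rightarrow> bool" where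
  "is_open \<XX> U \<equiv> openin (top_of \<XX>) U"

abbreviation opens_below :: "('p, 'a) ringed_space \<Rightarrow> 'p set \<Rightarrow> 'p set set" where
  "opens_below \<XX> U \<equiv> {W. is_open \<XX> W \<and> W \<subseteq> U}"

definition is_ringed_space :: "('p, 'a) ringed_space \<Rightarrow> bool" where
  "is_ringed_space \<XX> \<longleftrightarrow>
    (\<forall>U. is_open \<XX> U \<longrightarrow> cring (sec \<XX> U)) \<and>
    (\<forall>U V. is_open \<XX> U \<and> is_open \<XX> V \<and> V \<subseteq> U \<longrightarrow> res \<XX> U V \<in> ring_hom (sec \<XX> U) (sec \<XX> V)) \<and>
    sheaf_of_sets (top_of \<XX>) (\<lambda>U. carrier (sec \<XX> U)) (res \<XX>)"

definition Spec :: "'a ring \<Rightarrow> 'a set set" where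
  "Spec A = {P. primeideal P A}"

definition zariski_topology :: "'a ring \<Rightarrow> 'a set topology" where
  "zariski_topology A = topology_generated_by {{P \<in> Spec A. f \<notin> P} | f. f \<in> carrier A}"

definition is_localization_at :: "'a ring \<Rightarrow> 'a \<Rightarrow> 'b ring \<Rightarrow> ('a \<Rightarrow> 'b) \<Rightarrow> bool" where
  "is_localization_at A f B h \<longleftrightarrow>
    h \<in> ring_hom A B \<and> h f \<in> Units B \<and>
    (\<forall>b\<in>carrier B. \<exists>n::nat. \<exists>a\<in>carrier A. b \<otimes>\<^bsub>B\<^esub> (h f [^]\<^bsub>B\<^esub> n) = h a) \<and>
    (\<forall>a\<in>carrier A. h a = \<zero>\<^bsub>B\<^esub> \<longrightarrow> (\<exists>n::nat. (f [^]\<^bsub>A\<^esub> n) \<otimes>\<^bsub>A\<^esub> a = \<zero>\<^bsub>A\<^esub>))"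

text \<open>
  The structure sheaf of \<open>Spec A\<close> is the sheaf whose value on the basic open set \<open>D(f)\<close> is the
  localization \<open>A\<^sub>f\<close>. So \<open>U\<close> with the restricted sheaf is an affine scheme iff it is
  homeomorphic to \<open>Spec A\<close>, \<open>A\<close> the ring of sections over \<open>U\<close>, in such a way that restriction
  to the preimage of \<open>D(f)\<close> is localization at \<open>f\<close>.
\<close>
definition affine_chart :: "('p, 'a) ringed_space \<Rightarrow> 'p set \<Rightarrow> ('p \<Rightarrow> 'a set) \<Rightarrow> bool" where
  "affine_chart \<XX> U \<phi> \<longleftrightarrow> is_open \<XX> U \<and>
    homeomorphic_map (subtopology (top_of \<XX>) U) (zariski_topology (sec \<XX> U)) \<phi> \<and>
    (\<forall>f\<in>carrier (sec \<XX> U).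
      is_localization_at (sec \<XX> U) f (sec \<XX> {x \<in> U. f \<notin> \<phi> x}) (res \<XX> U {x \<in> U. f \<notin> \<phi> x}))"

definition affine_open :: "('p, 'a) ringed_space \<Rightarrow> 'p set \<Rightarrow> bool" where
  "affine_open \<XX> U \<longleftrightarrow> (\<exists>\<phi>. affine_chart \<XX> U \<phi>)"

definition scheme :: "('p, 'a) ringed_space \<Rightarrow> bool" where
  "scheme \<XX> \<longleftrightarrow> is_ringed_space \<XX> \<and> (\<forall>x\<in>pts \<XX>. \<exists>U. x \<in> U \<and> affine_open \<XX> U)"

text \<open>The germ at \<open>x\<close> of a section over \<open>U\<close> is a unit of the stalk.\<close>
definition germ_unit :: "('p, 'a) ringed_space \<Rightarrow> 'p \<Rightarrow> 'p set \<Rightarrow> 'a \<Rightarrow> bool" where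
  "germ_unit \<XX> x U s \<longleftrightarrow> (\<exists>V. is_open \<XX> V \<and> x \<in> V \<and> V \<subseteq> U \<and> res \<XX> U V s \<in> Units (sec \<XX> V))"

record ('q, 'b, 'p, 'a) morphism =
  pmap :: "'q \<Rightarrow> 'p"
  pull :: "'p set \<Rightarrow> 'a \<Rightarrow> 'b"

definition preim :: "('q, 'b) ringed_space \<Rightarrow> ('q, 'b, 'p, 'a) morphism \<Rightarrow> 'p set \<Rightarrow> 'q set" where
  "preim Y f U = {y \<in> pts Y. pmap f y \<in> U}"

text \<open>Morphisms of locally ringed spaces; the last clause says that the maps of stalks are local.\<close>
definition is_morphism ::
  "('q, 'b) ringed_space \<Rightarrow> ('p, 'a) ringed_space \<Rightarrow> ('q, 'b, 'p, 'a) morphism \<Rightarrow> bool" where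
  "is_morphism Y \<XX> f \<longleftrightarrow>
    continuous_map (top_of Y) (top_of \<XX>) (pmap f) \<and>
    (\<forall>U. is_open \<XX> U \<longrightarrow> pull f U \<in> ring_hom (sec \<XX> U) (sec Y (preim Y f U))) \<and>
    (\<forall>U V. is_open \<XX> U \<and> is_open \<XX> V \<and> V \<subseteq> U \<longrightarrow> (\<forall>s\<in>carrier (sec \<XX> U).
      res Y (preim Y f U) (preim Y f V) (pull f U s) = pull f V (res \<XX> U V s))) \<and>
    (\<forall>y\<in>pts Y. \<forall>U. is_open \<XX> U \<and> pmap f y \<in> U \<longrightarrow> (\<forall>s\<in>carrier (sec \<XX> U).
      germ_unit Y y (preim Y f U) (pull f U s) \<longrightarrow> germ_unit \<XX> (pmap f y) U s))"

definition same_morphism ::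
  "('q, 'b) ringed_space \<Rightarrow> ('p, 'a) ringed_space \<Rightarrow> ('q, 'b, 'p, 'a) morphism
    \<Rightarrow> ('q, 'b, 'p, 'a) morphism \<Rightarrow> bool" where
  "same_morphism Y \<XX> f g \<longleftrightarrow>
    (\<forall>y\<in>pts Y. pmap f y = pmap g y) \<and>
    (\<forall>U. is_open \<XX> U \<longrightarrow> (\<forall>s\<in>carrier (sec \<XX> U). pull f U s = pull g U s))"

definition comp_morphism ::
  "('q, 'b) ringed_space \<Rightarrow> ('q, 'b, 'p, 'a) morphism \<Rightarrow> ('t, 'd, 'q, 'b) morphism
    \<Rightarrow> ('t, 'd, 'p, 'a) morphism" where
  "comp_morphism Y f h =
    \<lparr>pmap = pmap f \<circ> pmap h, pull = (\<lambda>U s. pull h (preim Y f U) (pull f U s))\<rparr>"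

section \<open>Varieties over a field\<close>

text \<open>A morphism from \<open>\<XX>\<close> to \<open>Spec F\<close> is a ring homomorphism from \<open>F\<close> to the global sections.\<close>
definition structure_map :: "('p, 'a) ringed_space \<Rightarrow> ('f::field \<Rightarrow> 'a) \<Rightarrow> bool" where
  "structure_map \<XX> c \<longleftrightarrow> c \<in> ring_hom (ring_of_type_algebra :: 'f ring) (sec \<XX> (pts \<XX>))"

definition finite_type :: "('p, 'a) ringed_space \<Rightarrow> ('f::field \<Rightarrow> 'a) \<Rightarrow> bool" where
  "finite_type \<XX> c \<longleftrightarrow> (\<exists>\<U>. finite \<U> \<and> \<Union>\<U> = pts \<XX> \<and>
    (\<forall>U\<in>\<U>. affine_open \<XX> U \<and> (\<exists>S. finite S \<and> S \<subseteq> carrier (sec \<XX> U) \<and>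
      generate_ring (sec \<XX> U) (range (\<lambda>a. res \<XX> (pts \<XX>) U (c a)) \<union> S) = carrier (sec \<XX> U))))"

text \<open>
  The diagonal is a closed immersion. The products \<open>U \<times> V\<close> with \<open>U\<close>, \<open>V\<close> affine open
  cover \<open>\<XX> \<times> \<XX>\<close>, and over such a product the diagonal is the morphism from \<open>U \<inter> V\<close> to
  the spectrum of the tensor product of the two section rings, given by the products of restrictions.
\<close>
definition separated :: "('p, 'a) ringed_space \<Rightarrow> bool" where
  "separated \<XX> \<longleftrightarrow> (\<forall>U V. affine_open \<XX> U \<and> affine_open \<XX> V \<longrightarrow>
    affine_open \<XX> (U \<inter> V) \<and>
    generate_ring (sec \<XX> (U \<inter> V))
      (res \<XX> U (U \<inter> V) ` carrier (sec \<XX> U) \<union> res \<XX> V (U \<inter> V) ` carrier (sec \<XX> V))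
      = carrier (sec \<XX> (U \<inter> V)))"

definition variety :: "('p, 'a) ringed_space \<Rightarrow> ('f::field \<Rightarrow> 'a) \<Rightarrow> bool" where
  "variety \<XX> c \<longleftrightarrow> scheme \<XX> \<and> structure_map \<XX> c \<and> finite_type \<XX> c \<and> separated \<XX>"

section \<open>Sheaves of modules and of ideals\<close>

record ('p, 'a, 'm) module_sheaf =
  msec :: "'p set \<Rightarrow> ('a, 'm) module"
  mres :: "'p set \<Rightarrow> 'p set \<Rightarrow> 'm \<Rightarrow> 'm"

definition is_module_sheaf :: "('p, 'a) ringed_space \<Rightarrow> ('p, 'a, 'm) module_sheaf \<Rightarrow> bool" where
  "is_module_sheaf \<XX> M \<longleftrightarrow>
    (\<forall>U. is_open \<XX> U \<longrightarrow> Module.module (sec \<XX> U) (msec M U)) \<and>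
    sheaf_of_sets (top_of \<XX>) (\<lambda>U. carrier (msec M U)) (mres M) \<and>
    (\<forall>U V. is_open \<XX> U \<and> is_open \<XX> V \<and> V \<subseteq> U \<longrightarrow>
      (\<forall>s\<in>carrier (msec M U). \<forall>t\<in>carrier (msec M U).
        mres M U V (s \<oplus>\<^bsub>msec M U\<^esub> t) = mres M U V s \<oplus>\<^bsub>msec M V\<^esub> mres M U V t) \<and>
      (\<forall>a\<in>carrier (sec \<XX> U). \<forall>s\<in>carrier (msec M U).
        mres M U V (a \<odot>\<^bsub>msec M U\<^esub> s) = res \<XX> U V a \<odot>\<^bsub>msec M V\<^esub> mres M U V s))"

definition frame_on ::
  "('p, 'a) ringed_space \<Rightarrow> ('p, 'a, 'm) module_sheaf \<Rightarrow> 'p set \<Rightarrow> nat \<Rightarrow> (nat \<Rightarrow> 'm) \<Rightarrow> bool" where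
  "frame_on \<XX> M U n e \<longleftrightarrow> is_open \<XX> U \<and> (\<forall>i<n. e i \<in> carrier (msec M U)) \<and>
    (\<forall>V\<in>opens_below \<XX> U. \<forall>s\<in>carrier (msec M V).
      \<exists>!a. a \<in> {..<n} \<rightarrow>\<^sub>E carrier (sec \<XX> V) \<and>
        s = (\<Oplus>\<^bsub>msec M V\<^esub>i\<in>{..<n}. a i \<odot>\<^bsub>msec M V\<^esub> mres M U V (e i)))"

definition locally_free_of_finite_rank ::
  "('p, 'a) ringed_space \<Rightarrow> ('p, 'a, 'm) module_sheaf \<Rightarrow> bool" where
  "locally_free_of_finite_rank \<XX> M \<longleftrightarrow> is_module_sheaf \<XX> M \<and>
    (\<forall>x\<in>pts \<XX>. \<exists>U n e. x \<in> U \<and> frame_on \<XX> M U n e)"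

text \<open>Linear morphisms of sheaves from \<open>M\<close> restricted to \<open>U\<close> to the structure sheaf of \<open>U\<close>.\<close>
definition sheaf_forms ::
  "('p, 'a) ringed_space \<Rightarrow> ('p, 'a, 'm) module_sheaf \<Rightarrow> 'p set \<Rightarrow> ('p set \<Rightarrow> 'm \<Rightarrow> 'a) set" where
  "sheaf_forms \<XX> M U = {l \<in> extensional (opens_below \<XX> U).
    (\<forall>V\<in>opens_below \<XX> U.
      l V \<in> carrier (msec M V) \<rightarrow>\<^sub>E carrier (sec \<XX> V) \<and>
      (\<forall>s\<in>carrier (msec M V). \<forall>t\<in>carrier (msec M V).
        l V (s \<oplus>\<^bsub>msec M V\<^esub> t) = l V s \<oplus>\<^bsub>sec \<XX> V\<^esub> l V t) \<and>
      (\<forall>a\<in>carrier (sec \<XX> V). \<forall>s\<in>carrier (msec M V).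
        l V (a \<odot>\<^bsub>msec M V\<^esub> s) = a \<otimes>\<^bsub>sec \<XX> V\<^esub> l V s)) \<and>
    (\<forall>V\<in>opens_below \<XX> U. \<forall>W\<in>opens_below \<XX> V. \<forall>s\<in>carrier (msec M V).
      res \<XX> V W (l V s) = l W (mres M V W s))}"

text \<open>The multiplicative fields of the module records play no role.\<close>
definition dual_sheaf ::
  "('p, 'a) ringed_space \<Rightarrow> ('p, 'a, 'm) module_sheaf \<Rightarrow> ('p, 'a, 'p set \<Rightarrow> 'm \<Rightarrow> 'a) module_sheaf" where
  "dual_sheaf \<XX> M = \<lparr>
    msec = (\<lambda>U. \<lparr>
      carrier = sheaf_forms \<XX> M U,
      monoid.mult = undefined,
      one = undefined,
      ring.zero = (\<lambda>V\<in>opens_below \<XX> U. \<lambda>s\<in>carrier (msec M V). \<zero>\<^bsub>sec \<XX> V\<^esub>),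
      add = (\<lambda>k l. \<lambda>V\<in>opens_below \<XX> U. \<lambda>s\<in>carrier (msec M V). k V s \<oplus>\<^bsub>sec \<XX> V\<^esub> l V s),
      smult = (\<lambda>a l. \<lambda>V\<in>opens_below \<XX> U. \<lambda>s\<in>carrier (msec M V). res \<XX> U V a \<otimes>\<^bsub>sec \<XX> V\<^esub> l V s)\<rparr>),
    mres = (\<lambda>U V l. restrict l (opens_below \<XX> V))\<rparr>"

definition is_ideal_sheaf :: "('p, 'a) ringed_space \<Rightarrow> ('p set \<Rightarrow> 'a set) \<Rightarrow> bool" where
  "is_ideal_sheaf \<XX> I \<longleftrightarrow>
    (\<forall>U. is_open \<XX> U \<longrightarrow> ideal (I U) (sec \<XX> U)) \<and> sheaf_of_sets (top_of \<XX>) I (res \<XX>)"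

text \<open>On an affine open set, the sections over \<open>D(f)\<close> are the localization of the sections at \<open>f\<close>.\<close>
definition quasi_coherent_ideal :: "('p, 'a) ringed_space \<Rightarrow> ('p set \<Rightarrow> 'a set) \<Rightarrow> bool" where
  "quasi_coherent_ideal \<XX> I \<longleftrightarrow> is_ideal_sheaf \<XX> I \<and>
    (\<forall>U \<phi>. affine_chart \<XX> U \<phi> \<longrightarrow> (\<forall>f\<in>carrier (sec \<XX> U).
      let V = {x \<in> U. f \<notin> \<phi> x} in
      \<forall>h\<in>I V. \<exists>n::nat. \<exists>a\<in>I U. h \<otimes>\<^bsub>sec \<XX> V\<^esub> (res \<XX> U V f [^]\<^bsub>sec \<XX> V\<^esub> n) = res \<XX> U V a))"

definition ideal_as_module ::
  "('p, 'a) ringed_space \<Rightarrow> ('p set \<Rightarrow> 'a set) \<Rightarrow> ('p, 'a, 'a) module_sheaf" where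
  "ideal_as_module \<XX> I = \<lparr>
    msec = (\<lambda>U. \<lparr>
      carrier = I U,
      monoid.mult = monoid.mult (sec \<XX> U),
      one = \<one>\<^bsub>sec \<XX> U\<^esub>,
      ring.zero = \<zero>\<^bsub>sec \<XX> U\<^esub>,
      add = add (sec \<XX> U),
      smult = monoid.mult (sec \<XX> U)\<rparr>),
    mres = res \<XX>\<rparr>"

text \<open>
  The ideal sheaf of the scheme of zeroes of a global section \<open>\<sigma>\<close> of \<open>E\<close>: the image sheaf of the
  morphism from the dual of \<open>E\<close> to the structure sheaf which evaluates forms at \<open>\<sigma>\<close>.
\<close>
definition zero_scheme_ideal ::
  "('p, 'a) ringed_space \<Rightarrow> ('p, 'a, 'm) module_sheaf \<Rightarrow> 'm \<Rightarrow> 'p set \<Rightarrow> 'a set" where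
  "zero_scheme_ideal \<XX> E \<sigma> U = {f \<in> carrier (sec \<XX> U). \<forall>x\<in>U. \<exists>V\<in>opens_below \<XX> U. x \<in> V \<and>
    (\<exists>l\<in>sheaf_forms \<XX> E V. res \<XX> U V f = l V (mres E (pts \<XX>) V \<sigma>))}"

section \<open>Blow-ups\<close>

text \<open>The ideal sheaf on \<open>Y\<close> generated by the pull-backs of the local sections of \<open>I\<close>.\<close>
definition inverse_image_ideal ::
  "('p, 'a) ringed_space \<Rightarrow> ('p set \<Rightarrow> 'a set) \<Rightarrow> ('q, 'b) ringed_space
    \<Rightarrow> ('q, 'b, 'p, 'a) morphism \<Rightarrow> 'q set \<Rightarrow> 'b set" where
  "inverse_image_ideal \<XX> I Y f V = {h \<in> carrier (sec Y V). \<forall>y\<in>V. \<exists>W\<in>opens_below Y V. y \<in> W \<and>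
    res Y V W h \<in> Idl\<^bsub>sec Y W\<^esub>
      {res Y (preim Y f U) W (pull f U s) | U s. is_open \<XX> U \<and> W \<subseteq> preim Y f U \<and> s \<in> I U}}"

text \<open>The ideal sheaf of an effective Cartier divisor: locally generated by one nonzerodivisor.\<close>
definition effective_cartier_ideal ::
  "('q, 'b) ringed_space \<Rightarrow> ('q set \<Rightarrow> 'b set) \<Rightarrow> bool" where
  "effective_cartier_ideal Y J \<longleftrightarrow> is_ideal_sheaf Y J \<and>
    (\<forall>y\<in>pts Y. \<exists>V g. is_open Y V \<and> y \<in> V \<and> g \<in> J V \<and>
      (\<forall>W\<in>opens_below Y V.
        J W = {a \<otimes>\<^bsub>sec Y W\<^esub> res Y V W g | a. a \<in> carrier (sec Y W)} \<and>
        (\<forall>a\<in>carrier (sec Y W). a \<otimes>\<^bsub>sec Y W\<^esub> res Y V W g = \<zero>\<^bsub>sec Y W\<^esub> \<longrightarrow> a = \<zero>\<^bsub>sec Y W\<^esub>)))"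

text \<open>
  The blow-up of \<open>I\<close> is the terminal object among the schemes over \<open>\<XX>\<close> on which the inverse image
  of \<open>I\<close> is the ideal sheaf of an effective Cartier divisor. As HOL does not quantify over types
  inside a formula, the test schemes live on the same types as \<open>Y\<close>; hence this predicate holds for
  every scheme having the universal property with respect to all schemes.
\<close>
definition is_blow_up ::
  "('p, 'a) ringed_space \<Rightarrow> ('p set \<Rightarrow> 'a set) \<Rightarrow> ('q, 'b) ringed_space
    \<Rightarrow> ('q, 'b, 'p, 'a) morphism \<Rightarrow> bool" where
  "is_blow_up \<XX> I Y \<pi> \<longleftrightarrow>
    scheme Y \<and> is_morphism Y \<XX> \<pi> \<and> effective_cartier_ideal Y (inverse_image_ideal \<XX> I Y \<pi>) \<and>
    (\<forall>(T :: ('q, 'b) ringed_space) g.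
      scheme T \<and> is_morphism T \<XX> g \<and> effective_cartier_ideal T (inverse_image_ideal \<XX> I T g) \<longrightarrow>
      (\<exists>h. is_morphism T Y h \<and> same_morphism T \<XX> (comp_morphism Y \<pi> h) g \<and>
        (\<forall>h'. is_morphism T Y h' \<and> same_morphism T \<XX> (comp_morphism Y \<pi> h') g \<longrightarrow>
          same_morphism T Y h' h)))"

definition pulled_back_structure ::
  "('p, 'a) ringed_space \<Rightarrow> ('f \<Rightarrow> 'a) \<Rightarrow> ('q, 'b, 'p, 'a) morphism \<Rightarrow> 'f \<Rightarrow> 'b" where
  "pulled_back_structure \<XX> c \<pi> = (\<lambda>a. pull \<pi> (pts \<XX>) (c a))"

text \<open>
  For \<open>J\<close> the ideal sheaf \<open>O(-D)\<close>, the line sheaf \<open>O(D)\<close> is its dual, and the canonical section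
  is the dual of the inclusion of \<open>O(-D)\<close> in the structure sheaf, i.e.\ that inclusion regarded
  as a section of \<open>O(D)\<close>.
\<close>
definition line_sheaf_of_divisor ::
  "('q, 'b) ringed_space \<Rightarrow> ('q set \<Rightarrow> 'b set) \<Rightarrow> ('q, 'b, 'q set \<Rightarrow> 'b \<Rightarrow> 'b) module_sheaf" where
  "line_sheaf_of_divisor Y J = dual_sheaf Y (ideal_as_module Y J)"

definition canonical_section ::
  "('q, 'b) ringed_space \<Rightarrow> ('q set \<Rightarrow> 'b set) \<Rightarrow> 'q set \<Rightarrow> 'b \<Rightarrow> 'b" where
  "canonical_section Y J = (\<lambda>V\<in>opens_below Y (pts Y). \<lambda>s\<in>J V. s)"

section \<open>Points over the algebraic closure\<close>

definition absolute_value :: "('k::field \<Rightarrow> real) \<Rightarrow> bool" where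
  "absolute_value v \<longleftrightarrow> (\<forall>a. 0 \<le> v a) \<and> (\<forall>a. v a = 0 \<longleftrightarrow> a = 0) \<and>
    (\<forall>a b. v (a * b) = v a * v b) \<and> (\<forall>a b. v (a + b) \<le> v a + v b)"

definition valued_field_topology :: "('k::field \<Rightarrow> real) \<Rightarrow> 'k topology" where
  "valued_field_topology v = Metric_space.mtopology UNIV (\<lambda>a b. v (a - b))"

text \<open>
  A point of \<open>\<XX>\<close> over the algebraic closure \<open>L\<close> of \<open>F\<close> is a morphism of \<open>F\<close>-schemes from \<open>Spec L\<close>
  to \<open>\<XX>\<close>: the image \<open>x\<close> of the unique point, together with the local homomorphisms \<open>ev U\<close> from
  the sections over the open sets \<open>U\<close> containing \<open>x\<close> to \<open>L\<close> (over the other open sets the target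
  is the zero ring).
\<close>
type_synonym ('p, 'a, 'f) geom_point = "'p \<times> ('p set \<Rightarrow> 'a \<Rightarrow> 'f alg_closure)"

definition geom_points ::
  "('p, 'a) ringed_space \<Rightarrow> ('f::field \<Rightarrow> 'a) \<Rightarrow> ('p, 'a, 'f) geom_point set" where
  "geom_points \<XX> c = {(x, ev). x \<in> pts \<XX> \<and> ev \<in> extensional {U. is_open \<XX> U \<and> x \<in> U} \<and>
    (\<forall>U. is_open \<XX> U \<and> x \<in> U \<longrightarrow>
      ev U \<in> extensional (carrier (sec \<XX> U)) \<and>
      ev U \<in> ring_hom (sec \<XX> U) (ring_of_type_algebra :: 'f alg_closure ring) \<and>
      (\<forall>V. is_open \<XX> V \<and> x \<in> V \<and> V \<subseteq> U \<longrightarrow> (\<forall>s\<in>carrier (sec \<XX> U). ev V (res \<XX> U V s) = ev U s)) \<and>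
      (\<forall>s\<in>carrier (sec \<XX> U). ev U s \<noteq> 0 \<longrightarrow> germ_unit \<XX> x U s)) \<and>
    (\<forall>a. ev (pts \<XX>) (c a) = to_ac a)}"

definition push_point ::
  "('p, 'a) ringed_space \<Rightarrow> ('q, 'b) ringed_space \<Rightarrow> ('q, 'b, 'p, 'a) morphism
    \<Rightarrow> ('q, 'b, 'f::field) geom_point \<Rightarrow> ('p, 'a, 'f) geom_point" where
  "push_point \<XX> Y \<pi> y = (pmap \<pi> (fst y),
    \<lambda>U\<in>{U. is_open \<XX> U \<and> pmap \<pi> (fst y) \<in> U}. \<lambda>s\<in>carrier (sec \<XX> U).
      snd y (preim Y \<pi> U) (pull \<pi> U s))"

text \<open>
  The topology on the set of points over the algebraic closure defined by the absolute value: the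
  coarsest one for which the points of each Zariski open set form an open set, on which the regular
  functions are continuous.
\<close>
definition analytic_topology ::
  "('f::field alg_closure \<Rightarrow> real) \<Rightarrow> ('p, 'a) ringed_space \<Rightarrow> ('f \<Rightarrow> 'a)
    \<Rightarrow> ('p, 'a, 'f) geom_point topology" where
  "analytic_topology v \<XX> c = topology_generated_by
    {{p \<in> geom_points \<XX> c. fst p \<in> U \<and> snd p U s \<in> B} | U s B.
      is_open \<XX> U \<and> s \<in> carrier (sec \<XX> U) \<and> openin (valued_field_topology v) B}"

section \<open>Fibres and metrics\<close>

text \<open>
  The fibre of \<open>M\<close> at a point \<open>p\<close> over the algebraic closure \<open>L\<close> is the tensor product of the stalk
  of \<open>M\<close> with \<open>L\<close> over the local ring. It is presented as a quotient of the space of formal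
  \<open>L\<close>-linear combinations of local sections of \<open>M\<close> around \<open>p\<close>, a local section being encoded as
  a pair of an open set and a section over it.
\<close>
type_synonym ('p, 'm, 'f) fsum = "('p set \<times> 'm) \<Rightarrow>\<^sub>0 'f alg_closure"

definition fsums ::
  "('p, 'a) ringed_space \<Rightarrow> ('p, 'a, 'm) module_sheaf \<Rightarrow> ('p, 'a, 'f::field) geom_point
    \<Rightarrow> ('p, 'm, 'f) fsum set" where
  "fsums \<XX> M p = {t. \<forall>(U, s)\<in>Poly_Mapping.keys t. is_open \<XX> U \<and> fst p \<in> U \<and> s \<in> carrier (msec M U)}"

inductive_set tensor_relations ::
  "('p, 'a) ringed_space \<Rightarrow> ('p, 'a, 'm) module_sheaf \<Rightarrow> ('p, 'a, 'f::field) geom_point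
    \<Rightarrow> ('p, 'm, 'f) fsum set"
  for \<XX> M p where
  zero: "0 \<in> tensor_relations \<XX> M p"
| plus: "r \<in> tensor_relations \<XX> M p \<Longrightarrow> r' \<in> tensor_relations \<XX> M p \<Longrightarrow> r + r' \<in> tensor_relations \<XX> M p"
| additive: "is_open \<XX> U \<Longrightarrow> fst p \<in> U \<Longrightarrow> s \<in> carrier (msec M U) \<Longrightarrow> t \<in> carrier (msec M U) \<Longrightarrow>
    Poly_Mapping.single (U, s \<oplus>\<^bsub>msec M U\<^esub> t) a - Poly_Mapping.single (U, s) a - Poly_Mapping.single (U, t) a
      \<in> tensor_relations \<XX> M p"
| balanced: "is_open \<XX> U \<Longrightarrow> fst p \<in> U \<Longrightarrow> s \<in> carrier (msec M U) \<Longrightarrow> h \<in> carrier (sec \<XX> U) \<Longrightarrow>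
    Poly_Mapping.single (U, h \<odot>\<^bsub>msec M U\<^esub> s) a - Poly_Mapping.single (U, s) (a * snd p U h)
      \<in> tensor_relations \<XX> M p"
| germ: "is_open \<XX> U \<Longrightarrow> is_open \<XX> V \<Longrightarrow> fst p \<in> V \<Longrightarrow> V \<subseteq> U \<Longrightarrow> s \<in> carrier (msec M U) \<Longrightarrow>
    Poly_Mapping.single (U, s) a - Poly_Mapping.single (V, mres M U V s) a \<in> tensor_relations \<XX> M p"

definition fibre_class ::
  "('p, 'a) ringed_space \<Rightarrow> ('p, 'a, 'm) module_sheaf \<Rightarrow> ('p, 'a, 'f::field) geom_point
    \<Rightarrow> ('p, 'm, 'f) fsum \<Rightarrow> ('p, 'm, 'f) fsum set" where
  "fibre_class \<XX> M p t = {t' \<in> fsums \<XX> M p. t' - t \<in> tensor_relations \<XX> M p}"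

definition fibre ::
  "('p, 'a) ringed_space \<Rightarrow> ('p, 'a, 'm) module_sheaf \<Rightarrow> ('p, 'a, 'f::field) geom_point
    \<Rightarrow> ('p, 'm, 'f) fsum set set" where
  "fibre \<XX> M p = fibre_class \<XX> M p ` fsums \<XX> M p"

text \<open>The value of a section in the fibre.\<close>
definition value_at ::
  "('p, 'a) ringed_space \<Rightarrow> ('p, 'a, 'm) module_sheaf \<Rightarrow> 'p set \<Rightarrow> 'm \<Rightarrow> ('p, 'a, 'f::field) geom_point
    \<Rightarrow> ('p, 'm, 'f) fsum set" where
  "value_at \<XX> M U s p = fibre_class \<XX> M p (Poly_Mapping.single (U, s) 1)"

definition fibre_norm ::
  "('f::field alg_closure \<Rightarrow> real) \<Rightarrow> ('p, 'a) ringed_space \<Rightarrow> ('p, 'a, 'm) module_sheaf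
    \<Rightarrow> ('p, 'a, 'f) geom_point \<Rightarrow> (('p, 'm, 'f) fsum set \<Rightarrow> real) \<Rightarrow> bool" where
  "fibre_norm v \<XX> M p N \<longleftrightarrow> N \<in> extensional (fibre \<XX> M p) \<and>
    (\<forall>t\<in>fsums \<XX> M p.
      0 \<le> N (fibre_class \<XX> M p t) \<and>
      (N (fibre_class \<XX> M p t) = 0 \<longleftrightarrow> fibre_class \<XX> M p t = fibre_class \<XX> M p 0) \<and>
      (\<forall>a. N (fibre_class \<XX> M p (Poly_Mapping.map ((*) a) t)) = v a * N (fibre_class \<XX> M p t)) \<and>
      (\<forall>t'\<in>fsums \<XX> M p.
        N (fibre_class \<XX> M p (t + t')) \<le> N (fibre_class \<XX> M p t) + N (fibre_class \<XX> M p t')))"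

text \<open>
  Continuous dependence on the point means continuity on the total space of the bundle, i.e.\ of
  the norm of all combinations of sections as a function of the point and of the coefficients.
  Continuity of the norms of sections alone would be weaker in rank at least two, because the
  coefficients lie in the algebraic closure while the sections are defined over the ground field.
\<close>
definition metric_on ::
  "('f::field alg_closure \<Rightarrow> real) \<Rightarrow> ('p, 'a) ringed_space \<Rightarrow> ('f \<Rightarrow> 'a) \<Rightarrow> ('p, 'a, 'm) module_sheaf
    \<Rightarrow> (('p, 'a, 'f) geom_point \<Rightarrow> ('p, 'm, 'f) fsum set \<Rightarrow> real) \<Rightarrow> bool" where
  "metric_on v \<XX> c M N \<longleftrightarrow> N \<in> extensional (geom_points \<XX> c) \<and>
    (\<forall>p\<in>geom_points \<XX> c. fibre_norm v \<XX> M p (N p)) \<and>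
    (\<forall>U (n::nat) s. is_open \<XX> U \<and> (\<forall>i<n. s i \<in> carrier (msec M U)) \<longrightarrow>
      continuous_map
        (prod_topology (subtopology (analytic_topology v \<XX> c) {p. fst p \<in> U})
          (product_topology (\<lambda>_. valued_field_topology v) {..<n}))
        euclideanreal
        (\<lambda>(p, a). N p (fibre_class \<XX> M p (\<Sum>i<n. Poly_Mapping.single (U, s i) (a i)))))"

definition lin_ext :: "('g \<Rightarrow> 'k::field) \<Rightarrow> ('g \<Rightarrow>\<^sub>0 'k) \<Rightarrow> 'k" where
  "lin_ext b t = (\<Sum>g\<in>Poly_Mapping.keys t. Poly_Mapping.lookup t g * b g)"

text \<open>
  Evaluation at \<open>\<sigma>\<close> maps the dual of \<open>E\<close> to the ideal sheaf \<open>I\<close> of its zeroes, whence a morphism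
  from the pull-back to \<open>Y\<close> of the dual of \<open>E\<close> to \<open>J = O(-D)\<close>, whose transpose is a morphism from
  \<open>O(D)\<close> to the pull-back of \<open>E\<close>. The predicate says that on fibres at \<open>y\<close> the transpose sends the
  class of \<open>u\<close> to the class of \<open>w\<close>: the fibre of the pull-back of \<open>E\<close> at \<open>y\<close> is the fibre of \<open>E\<close> at
  \<open>\<pi>(y)\<close>, and the two sides are the pairings of \<open>u\<close> with the pull-back of \<open>l(\<sigma>)\<close> and of \<open>w\<close> with \<open>l\<close>,
  for a local section \<open>l\<close> of the dual of \<open>E\<close>.
\<close>
definition transpose_maps_to ::
  "('p, 'a) ringed_space \<Rightarrow> ('p, 'a, 'm) module_sheaf \<Rightarrow> 'm \<Rightarrow> ('q, 'b) ringed_space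
    \<Rightarrow> ('q, 'b, 'p, 'a) morphism \<Rightarrow> ('q, 'b, 'f::field) geom_point
    \<Rightarrow> ('q, 'q set \<Rightarrow> 'b \<Rightarrow> 'b, 'f) fsum \<Rightarrow> ('p, 'm, 'f) fsum \<Rightarrow> bool" where
  "transpose_maps_to \<XX> E \<sigma> Y \<pi> y u w \<longleftrightarrow>
    (\<forall>U l. is_open \<XX> U \<and> pmap \<pi> (fst y) \<in> U \<and> l \<in> sheaf_forms \<XX> E U \<longrightarrow>
      lin_ext (\<lambda>(V, k). let W = V \<inter> preim Y \<pi> U in
          snd y W (k W (res Y (preim Y \<pi> U) W (pull \<pi> U (l U (mres E (pts \<XX>) U \<sigma>)))))) u
      = lin_ext (\<lambda>(V, e). snd (push_point \<XX> Y \<pi> y) (V \<inter> U) (l (V \<inter> U) (mres E V (V \<inter> U) e))) w)"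

text \<open>The metric for which this morphism from \<open>O(D)\<close> to the pull-back of \<open>E\<close> is isometric.\<close>
definition induced_from ::
  "('p, 'a) ringed_space \<Rightarrow> ('f::field \<Rightarrow> 'a) \<Rightarrow> ('p, 'a, 'm) module_sheaf \<Rightarrow> 'm
    \<Rightarrow> (('p, 'a, 'f) geom_point \<Rightarrow> ('p, 'm, 'f) fsum set \<Rightarrow> real)
    \<Rightarrow> ('q, 'b) ringed_space \<Rightarrow> ('q, 'b, 'p, 'a) morphism \<Rightarrow> ('q set \<Rightarrow> 'b set)
    \<Rightarrow> (('q, 'b, 'f) geom_point \<Rightarrow> ('q, 'q set \<Rightarrow> 'b \<Rightarrow> 'b, 'f) fsum set \<Rightarrow> real) \<Rightarrow> bool" where
  "induced_from \<XX> c E \<sigma> N Y \<pi> J N' \<longleftrightarrow>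
    (\<forall>y\<in>geom_points Y (pulled_back_structure \<XX> c \<pi>).
      \<forall>u\<in>fsums Y (line_sheaf_of_divisor Y J) y. \<forall>w\<in>fsums \<XX> E (push_point \<XX> Y \<pi> y).
        transpose_maps_to \<XX> E \<sigma> Y \<pi> y u w \<longrightarrow>
        N' y (fibre_class Y (line_sheaf_of_divisor Y J) y u)
          = N (push_point \<XX> Y \<pi> y) (fibre_class \<XX> E (push_point \<XX> Y \<pi> y) w))"

end

theory Submission
  imports Defs
begin

text \<open>
  Around a point \<open>x\<close> of \<open>\<XX>\<close> choose a frame \<open>e\<^sub>i\<close> of \<open>E\<close> with dual frame \<open>d\<^sub>i\<close>, so that
  \<open>\<sigma> = \<Sum>\<^sub>i f\<^sub>i e\<^sub>i\<close> with \<open>f\<^sub>i = d\<^sub>i(\<sigma>)\<close>. Over a point \<open>y\<close> above \<open>x\<close>, the transpose of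
  evaluation at \<open>\<sigma>\<close> sends a local section \<open>k\<close> of \<open>O(D)\<close> to \<open>\<Sum>\<^sub>i k(\<pi>\<^sup>*f\<^sub>i) \<pi>\<^sup>*e\<^sub>i\<close>, and the
  metric on \<open>O(D)\<close> is the one pulled back along this map. The map is injective on fibres: if
  \<open>g\<close> is a local equation of \<open>D\<close> and \<open>h\<close> the form with \<open>h(g) = 1\<close>, and all \<open>h(\<pi>\<^sup>*f\<^sub>i)\<close>
  vanished at \<open>y\<close>, then \<open>h(j)\<close> would vanish at \<open>y\<close> for every \<open>j\<close> in \<open>O(-D)\<close>, because the
  \<open>f\<^sub>i\<close> generate \<open>I\<close> and hence the \<open>\<pi>\<^sup>*f\<^sub>i\<close> generate \<open>O(-D)\<close>; but \<open>h(g) = 1\<close>. Continuity holds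
  because the coefficients \<open>k(\<pi>\<^sup>*f\<^sub>i)\<close> are regular functions. The canonical section takes
  \<open>\<pi>\<^sup>*f\<^sub>i\<close> to itself, so that its image is \<open>\<pi>\<^sup>*\<sigma>\<close>.
\<close>

section \<open>Formal sums and fibres\<close>

text \<open>\<open>lin_ext\<close> sums over the support, and supports can shrink under
  cancellation. Terms outside the support contribute zero, so several formal sums can be evaluated
  over one common finite index set.\<close>

lemma lin_ext_superset:
  assumes "finite A" "Poly_Mapping.keys t \<subseteq> A"
  shows "lin_ext b t = (\<Sum>g\<in>A. Poly_Mapping.lookup t g * b g)"
  unfolding lin_ext_def
  by (rule sum.mono_neutral_left) (use assms in \<open>auto simp: in_keys_iff\<close>)

lemma lin_ext_0 [simp]: "lin_ext b 0 = 0"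
  by (simp add: lin_ext_def)

lemma lin_ext_single [simp]: "lin_ext b (Poly_Mapping.single g a) = a * b g"
  by (simp add: lin_ext_def)

lemma lin_ext_add: "lin_ext b (s + t) = lin_ext b s + lin_ext b t"
proof -
  let ?A = "Poly_Mapping.keys s \<union> Poly_Mapping.keys t"
  have "Poly_Mapping.keys (s + t) \<subseteq> ?A"
    by (rule keys_add)
  then show ?thesis
    by (simp add: lin_ext_superset[of ?A] lookup_add sum.distrib distrib_right)
qed

lemma lin_ext_uminus: "lin_ext b (- t) = - lin_ext b t"
  by (metis add_eq_0_iff lin_ext_0 lin_ext_add neg_eq_iff_add_eq_0)

lemma lin_ext_diff: "lin_ext b (s - t) = lin_ext b s - lin_ext b t"
  using lin_ext_add[of b s "- t"] by (simp add: lin_ext_uminus)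

lemma lin_ext_sum: "lin_ext b (\<Sum>i\<in>A. t i) = (\<Sum>i\<in>A. lin_ext b (t i))"
  by (induction A rule: infinite_finite_induct) (auto simp: lin_ext_add)

lemma lookup_scale: "Poly_Mapping.lookup (Poly_Mapping.map ((*) (a::'k::field)) t) g = a * Poly_Mapping.lookup t g"
  by (simp add: Poly_Mapping.map.rep_eq when_def)

lemma lin_ext_scale: "lin_ext b (Poly_Mapping.map ((*) a) t) = a * lin_ext b t"
proof -
  have "Poly_Mapping.keys (Poly_Mapping.map ((*) a) t) \<subseteq> Poly_Mapping.keys t"
    by (auto simp: in_keys_iff lookup_scale)
  then show ?thesis
    by (subst lin_ext_superset[of "Poly_Mapping.keys t"])
      (simp_all add: lookup_scale sum_distrib_left mult.assoc lin_ext_def)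
qed

lemma lin_ext_cong:
  assumes "\<And>g. g \<in> Poly_Mapping.keys t \<Longrightarrow> b g = b' g"
  shows "lin_ext b t = lin_ext b' t"
  unfolding lin_ext_def using assms by (auto intro: sum.cong)

text \<open>Reduces statements about arbitrary elements of a fibre to the generators
  \<open>Poly_Mapping.single (V, s) a\<close>.\<close>

lemma poly_mapping_sum_singles:
  "t = (\<Sum>g\<in>Poly_Mapping.keys t. Poly_Mapping.single g (Poly_Mapping.lookup t g))"
proof (rule poly_mapping_eqI)
  fix h
  have "Poly_Mapping.lookup (\<Sum>g\<in>Poly_Mapping.keys t. Poly_Mapping.single g (Poly_Mapping.lookup t g)) h
    = (\<Sum>g\<in>Poly_Mapping.keys t. if g = h then Poly_Mapping.lookup t g else 0)"
    by (simp add: lookup_sum lookup_single when_def)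
  then show "Poly_Mapping.lookup t h =
    Poly_Mapping.lookup (\<Sum>g\<in>Poly_Mapping.keys t. Poly_Mapping.single g (Poly_Mapping.lookup t g)) h"
    by (simp add: in_keys_iff)
qed

text \<open>The inductive definition offers no clause for negatives. Each generating family is
  stable under replacing its coefficient \<open>a\<close> by \<open>- a\<close>, so the relations
  form a subgroup.\<close>

lemma tensor_relations_uminus:
  "r \<in> tensor_relations \<XX> M p \<Longrightarrow> - r \<in> tensor_relations \<XX> M p"
proof (induction rule: tensor_relations.induct)
  case zero
  then show ?case by (simp add: tensor_relations.zero)
next
  case (plus r r')
  then show ?case using tensor_relations.plus by fastforce
next
  case (additive U s t a)
  then show ?case
    using tensor_relations.additive[of \<XX> U p s M t "- a"] by (simp add: single_uminus algebra_simps)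
next
  case (balanced U s h a)
  then show ?case
    using tensor_relations.balanced[of \<XX> U p s M h "- a"] by (simp add: single_uminus)
next
  case (germ U V s a)
  then show ?case
    using tensor_relations.germ[of \<XX> U V p s M "- a"] by (simp add: single_uminus)
qed

lemma tensor_relations_diff:
  "r \<in> tensor_relations \<XX> M p \<Longrightarrow> r' \<in> tensor_relations \<XX> M p \<Longrightarrow> r - r' \<in> tensor_relations \<XX> M p"
  using tensor_relations.plus tensor_relations_uminus by fastforce

lemma tensor_relations_trans:
  "r - s \<in> tensor_relations \<XX> M p \<Longrightarrow> s - t \<in> tensor_relations \<XX> M p \<Longrightarrow> r - t \<in> tensor_relations \<XX> M p"
  using tensor_relations.plus by fastforce

lemma tensor_relations_sum:
  assumes "\<And>i. i \<in> A \<Longrightarrow> r i \<in> tensor_relations \<XX> M p"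
  shows "(\<Sum>i\<in>A. r i) \<in> tensor_relations \<XX> M p"
  using assms by (induction A rule: infinite_finite_induct) (auto intro: tensor_relations.intros)

text \<open>The relations contain zero and are closed under sums and negatives, so classes behave as
  cosets and the usual criterion for equality in a quotient group applies.\<close>

lemma fibre_class_eq_iff:
  assumes "t \<in> fsums \<XX> M p" "t' \<in> fsums \<XX> M p"
  shows "fibre_class \<XX> M p t = fibre_class \<XX> M p t' \<longleftrightarrow> t - t' \<in> tensor_relations \<XX> M p"
proof
  assume "fibre_class \<XX> M p t = fibre_class \<XX> M p t'"
  moreover have "t \<in> fibre_class \<XX> M p t"
    using assms by (simp add: fibre_class_def tensor_relations.zero)
  ultimately show "t - t' \<in> tensor_relations \<XX> M p"
    by (simp add: fibre_class_def)
next
  assume *: "t - t' \<in> tensor_relations \<XX> M p"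
  then have "t' - t \<in> tensor_relations \<XX> M p"
    using tensor_relations_uminus by fastforce
  with * show "fibre_class \<XX> M p t = fibre_class \<XX> M p t'"
    unfolding fibre_class_def by (blast intro: tensor_relations_trans)
qed

lemma fsums_0: "0 \<in> fsums \<XX> M p"
  by (simp add: fsums_def)

lemma fsums_single:
  "is_open \<XX> U \<Longrightarrow> fst p \<in> U \<Longrightarrow> s \<in> carrier (msec M U) \<Longrightarrow> Poly_Mapping.single (U, s) a \<in> fsums \<XX> M p"
  by (simp add: fsums_def)

lemma fsums_add: "s \<in> fsums \<XX> M p \<Longrightarrow> t \<in> fsums \<XX> M p \<Longrightarrow> s + t \<in> fsums \<XX> M p"
  using keys_add[of s t] unfolding fsums_def by blast

lemma fsums_sum: "(\<And>i. i \<in> A \<Longrightarrow> t i \<in> fsums \<XX> M p) \<Longrightarrow> (\<Sum>i\<in>A. t i) \<in> fsums \<XX> M p"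
  by (induction A rule: infinite_finite_induct) (auto intro: fsums_0 fsums_add)

lemma fsums_scale: "t \<in> fsums \<XX> M p \<Longrightarrow> Poly_Mapping.map ((*) a) t \<in> fsums \<XX> M p"
  by (auto simp: fsums_def in_keys_iff lookup_scale)

text \<open>Additivity is asked only on a subset \<open>H\<close> closed under addition: in the
  application \<open>H\<close> consists of the sections of \<open>I\<close>, since only their
  pull-backs can be fed to a form on \<open>O(-D)\<close>. That zero goes to zero follows by
  cancellation in the target.\<close>

lemma finsum_additive:
  fixes \<phi> :: "'m \<Rightarrow> 'k::ab_group_add"
  assumes "abelian_monoid M" "finite A" "H \<subseteq> carrier M" "\<zero>\<^bsub>M\<^esub> \<in> H"
    and "\<And>x y. x \<in> H \<Longrightarrow> y \<in> H \<Longrightarrow> x \<oplus>\<^bsub>M\<^esub> y \<in> H"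
    and "\<And>x y. x \<in> H \<Longrightarrow> y \<in> H \<Longrightarrow> \<phi> (x \<oplus>\<^bsub>M\<^esub> y) = \<phi> x + \<phi> y"
    and "\<And>i. i \<in> A \<Longrightarrow> f i \<in> H"
  shows "(\<Oplus>\<^bsub>M\<^esub>i\<in>A. f i) \<in> H \<and> \<phi> (\<Oplus>\<^bsub>M\<^esub>i\<in>A. f i) = (\<Sum>i\<in>A. \<phi> (f i))"
proof -
  interpret abelian_monoid M by fact
  have "\<phi> \<zero>\<^bsub>M\<^esub> = \<phi> \<zero>\<^bsub>M\<^esub> + \<phi> \<zero>\<^bsub>M\<^esub>"
    using assms(4,6) by (metis l_zero zero_closed)
  then have "\<phi> \<zero>\<^bsub>M\<^esub> = 0" by simp
  with assms(2,7) show ?thesis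
  proof (induction A)
    case (insert i A)
    have "finsum M f (insert i A) = f i \<oplus>\<^bsub>M\<^esub> finsum M f A"
      by (rule finsum_insert) (use insert assms(3) in auto)
    with insert assms(5,6) show ?case by simp
  qed (use assms(4) in auto)
qed

text \<open>Cancellation in the target turns additivity into preservation of zero, after which
  induction applies. Serves both restriction maps of modules and values of forms.\<close>

lemma finsum_hom:
  assumes "abelian_monoid M" "abelian_group M'" "finite A"
    and "\<And>x. x \<in> carrier M \<Longrightarrow> \<phi> x \<in> carrier M'"
    and "\<And>x y. x \<in> carrier M \<Longrightarrow> y \<in> carrier M \<Longrightarrow> \<phi> (x \<oplus>\<^bsub>M\<^esub> y) = \<phi> x \<oplus>\<^bsub>M'\<^esub> \<phi> y"
    and "\<And>i. i \<in> A \<Longrightarrow> f i \<in> carrier M"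
  shows "\<phi> (\<Oplus>\<^bsub>M\<^esub>i\<in>A. f i) = (\<Oplus>\<^bsub>M'\<^esub>i\<in>A. \<phi> (f i))"
proof -
  interpret abelian_monoid M by fact
  interpret N: abelian_group M' by fact
  have "\<phi> \<zero>\<^bsub>M\<^esub> = \<phi> \<zero>\<^bsub>M\<^esub> \<oplus>\<^bsub>M'\<^esub> \<phi> \<zero>\<^bsub>M\<^esub>"
    using assms(5) by (metis l_zero zero_closed)
  then have "\<phi> \<zero>\<^bsub>M\<^esub> = \<zero>\<^bsub>M'\<^esub>"
    using assms(4) by (metis N.add.l_cancel_one' zero_closed)
  with assms(3,6) show ?thesis
  proof (induction A)
    case (insert i A)
    have "finsum M f (insert i A) = f i \<oplus>\<^bsub>M\<^esub> finsum M f A"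
      by (rule finsum_insert) (use insert in auto)
    moreover have "finsum M' (\<lambda>i. \<phi> (f i)) (insert i A) = \<phi> (f i) \<oplus>\<^bsub>M'\<^esub> finsum M' (\<lambda>i. \<phi> (f i)) A"
      by (rule N.finsum_insert) (use insert assms(4) in auto)
    moreover have "finsum M f A \<in> carrier M"
      by (rule finsum_closed) (use insert in auto)
    ultimately show ?case using insert assms(5) by auto
  qed auto
qed

lemma single_finsum_relation:
  assumes "abelian_monoid (msec M U)" "is_open \<XX> U" "fst p \<in> U" "finite A"
    and "\<And>i. i \<in> A \<Longrightarrow> f i \<in> carrier (msec M U)"
  shows "Poly_Mapping.single (U, \<Oplus>\<^bsub>msec M U\<^esub>i\<in>A. f i) a - (\<Sum>i\<in>A. Poly_Mapping.single (U, f i) a)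
    \<in> tensor_relations \<XX> M p"
  using assms(4,5)
proof (induction A)
  interpret abelian_monoid "msec M U" by fact
  case empty
  \<comment> \<open>For two zero summands the additivity relation collapses to minus one copy of the
    zero section, so the zero section itself is a relation.\<close>
  have "- Poly_Mapping.single (U, \<zero>\<^bsub>msec M U\<^esub>) a \<in> tensor_relations \<XX> M p"
    using tensor_relations.additive[of \<XX> U p "\<zero>\<^bsub>msec M U\<^esub>" M "\<zero>\<^bsub>msec M U\<^esub>" a] assms(2,3) by simp
  from tensor_relations_uminus[OF this] show ?case by simp
next
  interpret abelian_monoid "msec M U" by fact
  case (insert i A)
  let ?s = "finsum (msec M U) f A"
  have s: "?s \<in> carrier (msec M U)"
    by (rule finsum_closed) (use insert in auto)
  have eq: "finsum (msec M U) f (insert i A) = f i \<oplus>\<^bsub>msec M U\<^esub> ?s"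
    by (rule finsum_insert) (use insert in auto)
  have "Poly_Mapping.single (U, f i \<oplus>\<^bsub>msec M U\<^esub> ?s) a - Poly_Mapping.single (U, f i) a
      - Poly_Mapping.single (U, ?s) a \<in> tensor_relations \<XX> M p"
    by (rule tensor_relations.additive) (use s insert assms in auto)
  from tensor_relations.plus[OF this insert.IH] show ?case
    using insert by (simp add: eq diff_diff_eq add_ac)
qed

section \<open>Ringed spaces, forms and frames\<close>

locale ringed =
  fixes \<XX> :: "('p, 'a) ringed_space"
  assumes ringed: "is_ringed_space \<XX>"
begin

lemma sec_cring: "is_open \<XX> U \<Longrightarrow> cring (sec \<XX> U)"
  using ringed by (simp add: is_ringed_space_def)

lemma res_hom: "is_open \<XX> U \<Longrightarrow> is_open \<XX> V \<Longrightarrow> V \<subseteq> U \<Longrightarrow> res \<XX> U V \<in> ring_hom (sec \<XX> U) (sec \<XX> V)"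
  using ringed by (simp add: is_ringed_space_def)

lemma res_closed:
  "is_open \<XX> U \<Longrightarrow> is_open \<XX> V \<Longrightarrow> V \<subseteq> U \<Longrightarrow> s \<in> carrier (sec \<XX> U) \<Longrightarrow> res \<XX> U V s \<in> carrier (sec \<XX> V)"
  using res_hom by (blast intro: ring_hom_closed)

lemma res_id: "is_open \<XX> U \<Longrightarrow> s \<in> carrier (sec \<XX> U) \<Longrightarrow> res \<XX> U U s = s"
  using ringed by (simp add: is_ringed_space_def sheaf_of_sets_def)

lemma res_res:
  "is_open \<XX> U \<Longrightarrow> is_open \<XX> V \<Longrightarrow> is_open \<XX> W \<Longrightarrow> W \<subseteq> V \<Longrightarrow> V \<subseteq> U \<Longrightarrow> s \<in> carrier (sec \<XX> U) \<Longrightarrow>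
    res \<XX> V W (res \<XX> U V s) = res \<XX> U W s"
  using ringed by (simp add: is_ringed_space_def sheaf_of_sets_def)

lemma form_mem:
  "l \<in> sheaf_forms \<XX> M U \<Longrightarrow> is_open \<XX> V \<Longrightarrow> V \<subseteq> U \<Longrightarrow> s \<in> carrier (msec M V) \<Longrightarrow> l V s \<in> carrier (sec \<XX> V)"
  by (auto simp: sheaf_forms_def)

lemma form_add:
  "l \<in> sheaf_forms \<XX> M U \<Longrightarrow> is_open \<XX> V \<Longrightarrow> V \<subseteq> U \<Longrightarrow> s \<in> carrier (msec M V) \<Longrightarrow> t \<in> carrier (msec M V) \<Longrightarrow>
    l V (s \<oplus>\<^bsub>msec M V\<^esub> t) = l V s \<oplus>\<^bsub>sec \<XX> V\<^esub> l V t"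
  by (auto simp: sheaf_forms_def)

lemma form_smult:
  "l \<in> sheaf_forms \<XX> M U \<Longrightarrow> is_open \<XX> V \<Longrightarrow> V \<subseteq> U \<Longrightarrow> a \<in> carrier (sec \<XX> V) \<Longrightarrow> s \<in> carrier (msec M V) \<Longrightarrow>
    l V (a \<odot>\<^bsub>msec M V\<^esub> s) = a \<otimes>\<^bsub>sec \<XX> V\<^esub> l V s"
  by (auto simp: sheaf_forms_def)

lemma form_res:
  "l \<in> sheaf_forms \<XX> M U \<Longrightarrow> is_open \<XX> V \<Longrightarrow> V \<subseteq> U \<Longrightarrow> is_open \<XX> W \<Longrightarrow> W \<subseteq> V \<Longrightarrow> s \<in> carrier (msec M V) \<Longrightarrow>
    res \<XX> V W (l V s) = l W (mres M V W s)"
  by (auto simp: sheaf_forms_def)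

lemma form_restrict:
  assumes "l \<in> sheaf_forms \<XX> M U" "is_open \<XX> V" "V \<subseteq> U"
  shows "restrict l (opens_below \<XX> V) \<in> sheaf_forms \<XX> M V"
proof -
  have "W \<in> opens_below \<XX> U" if "W \<in> opens_below \<XX> V" for W
    using that assms by auto
  then show ?thesis
    using assms(1) by (auto simp: sheaf_forms_def)
qed

end

section \<open>Module sheaves and dual frames\<close>

locale ringed_module = ringed +
  fixes M :: "('a, 'b, 'm) module_sheaf"
  assumes module: "is_module_sheaf \<XX> M"
begin

lemma msec_module: "is_open \<XX> U \<Longrightarrow> Module.module (sec \<XX> U) (msec M U)"
  using module by (simp add: is_module_sheaf_def)

lemma mres_closed:
  "is_open \<XX> U \<Longrightarrow> is_open \<XX> V \<Longrightarrow> V \<subseteq> U \<Longrightarrow> s \<in> carrier (msec M U) \<Longrightarrow> mres M U V s \<in> carrier (msec M V)"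
  by (rule funcset_mem[of "mres M U V" "carrier (msec M U)"])
    (use module in \<open>simp_all add: is_module_sheaf_def sheaf_of_sets_def\<close>)

lemma mres_mres:
  "is_open \<XX> U \<Longrightarrow> is_open \<XX> V \<Longrightarrow> is_open \<XX> W \<Longrightarrow> W \<subseteq> V \<Longrightarrow> V \<subseteq> U \<Longrightarrow> s \<in> carrier (msec M U) \<Longrightarrow>
    mres M V W (mres M U V s) = mres M U W s"
  using module by (simp add: is_module_sheaf_def sheaf_of_sets_def)

lemma mres_add:
  "is_open \<XX> U \<Longrightarrow> is_open \<XX> V \<Longrightarrow> V \<subseteq> U \<Longrightarrow> s \<in> carrier (msec M U) \<Longrightarrow> t \<in> carrier (msec M U) \<Longrightarrow>
    mres M U V (s \<oplus>\<^bsub>msec M U\<^esub> t) = mres M U V s \<oplus>\<^bsub>msec M V\<^esub> mres M U V t"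
  using module by (simp add: is_module_sheaf_def)

lemma mres_smult:
  "is_open \<XX> U \<Longrightarrow> is_open \<XX> V \<Longrightarrow> V \<subseteq> U \<Longrightarrow> a \<in> carrier (sec \<XX> U) \<Longrightarrow> s \<in> carrier (msec M U) \<Longrightarrow>
    mres M U V (a \<odot>\<^bsub>msec M U\<^esub> s) = res \<XX> U V a \<odot>\<^bsub>msec M V\<^esub> mres M U V s"
  using module by (simp add: is_module_sheaf_def)

text \<open>This is the dual frame. Uniqueness of coordinates forces the coordinate functions to be
  additive, linear and compatible with restriction: in each case an explicit family of coefficients
  combines to the required section, hence is its family of coordinates.\<close>

lemma frame_on_coordinates:
  assumes "frame_on \<XX> M U n e"
  obtains d where "\<And>i. i < n \<Longrightarrow> d i \<in> sheaf_forms \<XX> M U"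
    and "\<And>V s. is_open \<XX> V \<Longrightarrow> V \<subseteq> U \<Longrightarrow> s \<in> carrier (msec M V) \<Longrightarrow>
      s = (\<Oplus>\<^bsub>msec M V\<^esub>i\<in>{..<n}. d i V s \<odot>\<^bsub>msec M V\<^esub> mres M U V (e i))"
proof -
  have U: "is_open \<XX> U" and e: "\<And>i. i < n \<Longrightarrow> e i \<in> carrier (msec M U)"
    using assms by (auto simp: frame_on_def)
  define comb where "comb V a = (\<Oplus>\<^bsub>msec M V\<^esub>i\<in>{..<n}. a i \<odot>\<^bsub>msec M V\<^esub> mres M U V (e i))" for V a
  define cf where "cf V s = (THE a. a \<in> {..<n} \<rightarrow>\<^sub>E carrier (sec \<XX> V) \<and> s = comb V a)" for V s
  have ex1: "\<exists>!a. a \<in> {..<n} \<rightarrow>\<^sub>E carrier (sec \<XX> V) \<and> s = comb V a"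
    if "is_open \<XX> V" "V \<subseteq> U" "s \<in> carrier (msec M V)" for V s
    using assms that unfolding frame_on_def comb_def by blast
  have cf: "cf V s \<in> {..<n} \<rightarrow>\<^sub>E carrier (sec \<XX> V)" "s = comb V (cf V s)"
    if "is_open \<XX> V" "V \<subseteq> U" "s \<in> carrier (msec M V)" for V s
    using theI'[OF ex1[OF that]] unfolding cf_def by auto
  \<comment> \<open>All three properties of the coordinate forms come from this fact: any family
    that combines to a section identifies the coordinates of that section.\<close>
  have cf_eq: "cf V (comb V a) i = a i"
    if V: "is_open \<XX> V" "V \<subseteq> U" and a: "\<And>i. i < n \<Longrightarrow> a i \<in> carrier (sec \<XX> V)" and "i < n" for V a i
  proof -
    interpret Module.module "sec \<XX> V" "msec M V" by (rule msec_module) fact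
    have eV: "mres M U V (e i) \<in> carrier (msec M V)" if "i < n" for i
      using mres_closed U V e that by blast
    have "comb V a \<in> carrier (msec M V)"
      unfolding comb_def by (rule M.finsum_closed) (use a eV in auto)
    from ex1[OF V this] have *: "cf V (comb V a) = b"
      if "b \<in> {..<n} \<rightarrow>\<^sub>E carrier (sec \<XX> V)" "comb V a = comb V b" for b
      unfolding cf_def using that by (auto intro!: the1_equality)
    \<comment> \<open>Uniqueness in \<open>frame_on\<close> is among extensional families, so
      \<open>a\<close> is cut down to \<open>{..<n}\<close> before the comparison.\<close>
    have "comb V a = comb V (restrict a {..<n})"
      unfolding comb_def by (rule M.finsum_cong') (use a eV in auto)
    then have "cf V (comb V a) = restrict a {..<n}"
      by (intro *) (use a in auto)
    with \<open>i < n\<close> show ?thesis by simp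
  qed
  define d where "d i = (\<lambda>V\<in>opens_below \<XX> U. \<lambda>s\<in>carrier (msec M V). cf V s i)" for i
  have d: "d i V s = cf V s i" if "is_open \<XX> V" "V \<subseteq> U" "s \<in> carrier (msec M V)" for i V s
    using that by (simp add: d_def)
  have cfc: "cf V s i \<in> carrier (sec \<XX> V)"
    if "is_open \<XX> V" "V \<subseteq> U" "s \<in> carrier (msec M V)" "i < n" for V s i
    using cf(1)[OF that(1-3)] that(4) by auto
  show thesis
  proof
    fix i assume i: "i < n"
    have add: "d i V (s \<oplus>\<^bsub>msec M V\<^esub> t) = d i V s \<oplus>\<^bsub>sec \<XX> V\<^esub> d i V t"
      if V: "is_open \<XX> V" "V \<subseteq> U" and s: "s \<in> carrier (msec M V)" and t: "t \<in> carrier (msec M V)" for V s t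
    proof -
      interpret Module.module "sec \<XX> V" "msec M V" by (rule msec_module) fact
      have eV: "mres M U V (e i) \<in> carrier (msec M V)" if "i < n" for i
        using mres_closed U V e that by blast
      have "s \<oplus>\<^bsub>msec M V\<^esub> t = comb V (cf V s) \<oplus>\<^bsub>msec M V\<^esub> comb V (cf V t)"
        using cf(2) V s t by metis
      also have "\<dots> = (\<Oplus>\<^bsub>msec M V\<^esub>i\<in>{..<n}. cf V s i \<odot>\<^bsub>msec M V\<^esub> mres M U V (e i)
          \<oplus>\<^bsub>msec M V\<^esub> cf V t i \<odot>\<^bsub>msec M V\<^esub> mres M U V (e i))"
        unfolding comb_def by (rule M.finsum_addf[symmetric]) (use cfc V s t eV in auto)
      also have "\<dots> = comb V (\<lambda>i. cf V s i \<oplus>\<^bsub>sec \<XX> V\<^esub> cf V t i)"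
        unfolding comb_def by (rule M.finsum_cong') (use cfc V s t eV smult_l_distr in auto)
      finally show ?thesis
        using cf_eq[of V "\<lambda>i. cf V s i \<oplus>\<^bsub>sec \<XX> V\<^esub> cf V t i" i] V s t i cfc
          d[OF V s] d[OF V t] d[OF V M.add.m_closed[OF s t]] by simp
    qed
    have smult: "d i V (a \<odot>\<^bsub>msec M V\<^esub> s) = a \<otimes>\<^bsub>sec \<XX> V\<^esub> d i V s"
      if V: "is_open \<XX> V" "V \<subseteq> U" and a: "a \<in> carrier (sec \<XX> V)" and s: "s \<in> carrier (msec M V)" for V a s
    proof -
      interpret Module.module "sec \<XX> V" "msec M V" by (rule msec_module) fact
      have eV: "mres M U V (e i) \<in> carrier (msec M V)" if "i < n" for i
        using mres_closed U V e that by blast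
      have "a \<odot>\<^bsub>msec M V\<^esub> s = a \<odot>\<^bsub>msec M V\<^esub> comb V (cf V s)"
        using cf(2) V s by metis
      also have "\<dots> = (\<Oplus>\<^bsub>msec M V\<^esub>i\<in>{..<n}. a \<odot>\<^bsub>msec M V\<^esub> (cf V s i \<odot>\<^bsub>msec M V\<^esub> mres M U V (e i)))"
        unfolding comb_def by (rule finsum_smult_ldistr) (use cfc V s a eV in auto)
      also have "\<dots> = comb V (\<lambda>i. a \<otimes>\<^bsub>sec \<XX> V\<^esub> cf V s i)"
        unfolding comb_def by (rule M.finsum_cong') (use cfc V s a eV smult_assoc1 in auto)
      finally show ?thesis
        using cf_eq[of V "\<lambda>i. a \<otimes>\<^bsub>sec \<XX> V\<^esub> cf V s i" i] V s a i cfc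
          d[OF V s] d[OF V smult_closed[OF a s]] by simp
    qed
    have res: "res \<XX> V W (d i V s) = d i W (mres M V W s)"
      if V: "is_open \<XX> V" "V \<subseteq> U" and W: "is_open \<XX> W" "W \<subseteq> V" and s: "s \<in> carrier (msec M V)" for V W s
    proof -
      interpret V: Module.module "sec \<XX> V" "msec M V" by (rule msec_module) fact
      interpret W: Module.module "sec \<XX> W" "msec M W" by (rule msec_module) fact
      have eV: "mres M U V (e i) \<in> carrier (msec M V)" "mres M U W (e i) \<in> carrier (msec M W)" if "i < n" for i
        using mres_closed U V W e that by auto
      have rcf: "res \<XX> V W (cf V s i) \<in> carrier (sec \<XX> W)" if "i < n" for i
        using res_closed cfc V W s that by blast
      \<comment> \<open>Restricting the expansion of \<open>s\<close> to \<open>W\<close> gives an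
        expansion there whose coefficients are the restricted coordinates.\<close>
      have "mres M V W s = mres M V W (comb V (cf V s))"
        using cf(2) V s by metis
      also have "\<dots> = (\<Oplus>\<^bsub>msec M W\<^esub>i\<in>{..<n}. mres M V W (cf V s i \<odot>\<^bsub>msec M V\<^esub> mres M U V (e i)))"
        unfolding comb_def
        by (rule finsum_hom) (use V.M.abelian_monoid_axioms W.M.abelian_group_axioms mres_closed mres_add
            cfc V W s eV in auto)
      also have "\<dots> = comb W (\<lambda>i. res \<XX> V W (cf V s i))"
        unfolding comb_def
        by (rule W.M.finsum_cong') (use cfc V W U s eV e rcf mres_smult mres_mres in auto)
      finally show ?thesis
        using cf_eq[of W "\<lambda>i. res \<XX> V W (cf V s i)" i] V W s i rcf mres_closed[OF V(1) W s]
          d[OF V s] d[of W "mres M V W s" i] by simp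
    qed
    show "d i \<in> sheaf_forms \<XX> M U"
      using add smult res i cfc unfolding sheaf_forms_def by (auto simp: d_def)
  next
    fix V s assume V: "is_open \<XX> V" "V \<subseteq> U" "s \<in> carrier (msec M V)"
    show "s = (\<Oplus>\<^bsub>msec M V\<^esub>i\<in>{..<n}. d i V s \<odot>\<^bsub>msec M V\<^esub> mres M U V (e i))"
      using cf(2)[OF V] V by (simp add: d comb_def)
  qed
qed

end

section \<open>Points over the algebraic closure and pairings on fibres\<close>

locale ringed_point = ringed +
  fixes c :: "'f::field \<Rightarrow> 'b" and p :: "('a, 'b, 'f) geom_point"
  assumes point: "p \<in> geom_points \<XX> c"
begin

lemma ev_hom:
  "is_open \<XX> U \<Longrightarrow> fst p \<in> U \<Longrightarrow> snd p U \<in> ring_hom (sec \<XX> U) (ring_of_type_algebra :: 'f alg_closure ring)"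
  using point by (auto simp: geom_points_def)

lemma ev_add:
  "is_open \<XX> U \<Longrightarrow> fst p \<in> U \<Longrightarrow> s \<in> carrier (sec \<XX> U) \<Longrightarrow> t \<in> carrier (sec \<XX> U) \<Longrightarrow>
    snd p U (s \<oplus>\<^bsub>sec \<XX> U\<^esub> t) = snd p U s + snd p U t"
  using ring_hom_add[OF ev_hom] by (simp add: ring_of_type_algebra_def)

lemma ev_mult:
  "is_open \<XX> U \<Longrightarrow> fst p \<in> U \<Longrightarrow> s \<in> carrier (sec \<XX> U) \<Longrightarrow> t \<in> carrier (sec \<XX> U) \<Longrightarrow>
    snd p U (s \<otimes>\<^bsub>sec \<XX> U\<^esub> t) = snd p U s * snd p U t"
  using ring_hom_mult[OF ev_hom] by (simp add: ring_of_type_algebra_def)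

lemma ev_one: "is_open \<XX> U \<Longrightarrow> fst p \<in> U \<Longrightarrow> snd p U \<one>\<^bsub>sec \<XX> U\<^esub> = 1"
  using ring_hom_one[OF ev_hom] by (simp add: ring_of_type_algebra_def)

lemma ev_res:
  "is_open \<XX> U \<Longrightarrow> is_open \<XX> V \<Longrightarrow> fst p \<in> V \<Longrightarrow> V \<subseteq> U \<Longrightarrow> s \<in> carrier (sec \<XX> U) \<Longrightarrow>
    snd p V (res \<XX> U V s) = snd p U s"
  using point subsetD[of V U "fst p"] by (auto simp: geom_points_def)

end

text \<open>The pairing of the fibre at \<open>p\<close> with a local form \<open>l\<close>, as on
  the right-hand side of \<open>transpose_maps_to\<close>. A generator over \<open>V\<close> is
  first restricted to \<open>V \<inter> U\<close>, because \<open>l\<close> lives only below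
  \<open>U\<close>.\<close>

definition form_value ::
  "('p, 'a, 'm) module_sheaf \<Rightarrow> ('p, 'a, 'f::field) geom_point \<Rightarrow> 'p set \<Rightarrow> ('p set \<Rightarrow> 'm \<Rightarrow> 'a)
    \<Rightarrow> ('p, 'm, 'f) fsum \<Rightarrow> 'f alg_closure" where
  "form_value M p U l = lin_ext (\<lambda>(V, e). snd p (V \<inter> U) (l (V \<inter> U) (mres M V (V \<inter> U) e)))"

locale ringed_module_point = ringed_module \<XX> M + ringed_point \<XX> c p
  for \<XX> :: "('p, 'a) ringed_space" and M :: "('p, 'a, 'm) module_sheaf"
    and c :: "'f::field \<Rightarrow> 'a" and p :: "('p, 'a, 'f) geom_point"
begin

text \<open>The pairing descends to the fibre. The three kinds of generating relation are killed by
  the additivity of a form, its linearity, and its compatibility with restriction,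
  respectively.\<close>

lemma form_value_relation:
  assumes U: "is_open \<XX> U" "fst p \<in> U" and l: "l \<in> sheaf_forms \<XX> M U"
    and r: "r \<in> tensor_relations \<XX> M p"
  shows "form_value M p U l r = 0"
  using r
proof (induction rule: tensor_relations.induct)
  case zero
  then show ?case by (simp add: form_value_def)
next
  case (plus r r')
  then show ?case by (simp add: form_value_def lin_ext_add)
next
  case (additive V s t a)
  then have W: "is_open \<XX> (V \<inter> U)" "fst p \<in> V \<inter> U" using U by auto
  interpret V: Module.module "sec \<XX> V" "msec M V" by (rule msec_module) fact
  have "mres M V (V \<inter> U) s \<in> carrier (msec M (V \<inter> U))" "mres M V (V \<inter> U) t \<in> carrier (msec M (V \<inter> U))"
    using mres_closed additive W by auto
  then show ?case
    using additive W l by (simp add: form_value_def lin_ext_diff mres_add form_add ev_add form_mem distrib_left)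
next
  case (balanced V s h a)
  then have W: "is_open \<XX> (V \<inter> U)" "fst p \<in> V \<inter> U" using U by auto
  have "mres M V (V \<inter> U) s \<in> carrier (msec M (V \<inter> U))" "res \<XX> V (V \<inter> U) h \<in> carrier (sec \<XX> (V \<inter> U))"
    using mres_closed res_closed balanced W by auto
  then show ?case
    using balanced W l by (simp add: form_value_def lin_ext_diff mres_smult form_smult ev_mult ev_res form_mem)
next
  case (germ V V' s a)
  then have W: "is_open \<XX> (V \<inter> U)" "is_open \<XX> (V' \<inter> U)" "fst p \<in> V \<inter> U" "fst p \<in> V' \<inter> U" using U by auto
  have s: "mres M V (V \<inter> U) s \<in> carrier (msec M (V \<inter> U))"
    using mres_closed germ W by auto
  have "V' \<inter> U \<subseteq> V \<inter> U" using germ by auto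
  have "snd p (V \<inter> U) (l (V \<inter> U) (mres M V (V \<inter> U) s))
    = snd p (V' \<inter> U) (res \<XX> (V \<inter> U) (V' \<inter> U) (l (V \<inter> U) (mres M V (V \<inter> U) s)))"
    by (rule ev_res[symmetric]) (use W s form_mem[OF l] germ in auto)
  also have "res \<XX> (V \<inter> U) (V' \<inter> U) (l (V \<inter> U) (mres M V (V \<inter> U) s))
    = l (V' \<inter> U) (mres M (V \<inter> U) (V' \<inter> U) (mres M V (V \<inter> U) s))"
    by (rule form_res[OF l]) (use W s germ in auto)
  also have "mres M (V \<inter> U) (V' \<inter> U) (mres M V (V \<inter> U) s) = mres M V' (V' \<inter> U) (mres M V V' s)"
    using germ W \<open>V' \<inter> U \<subseteq> V \<inter> U\<close> by (simp add: mres_mres)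
  finally show ?case
    by (simp add: form_value_def lin_ext_diff)
qed

text \<open>The values of the frame span the fibre and the dual forms read off the coordinates, so a
  class is determined by its pairings with the \<open>d i\<close>. By linearity it is enough to
  treat one generator: shrink it to a common open set, expand it there, move the coefficients into
  the field, and pass back to the frame over \<open>U\<close>.\<close>

lemma frame_decomposition:
  assumes "frame_on \<XX> M U n e" "fst p \<in> U"
    and d: "\<And>i. i < n \<Longrightarrow> d i \<in> sheaf_forms \<XX> M U"
    and dec: "\<And>V s. is_open \<XX> V \<Longrightarrow> V \<subseteq> U \<Longrightarrow> s \<in> carrier (msec M V) \<Longrightarrow>
      s = (\<Oplus>\<^bsub>msec M V\<^esub>i\<in>{..<n}. d i V s \<odot>\<^bsub>msec M V\<^esub> mres M U V (e i))"
    and w: "w \<in> fsums \<XX> M p"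
  shows "w - (\<Sum>i<n. Poly_Mapping.single (U, e i) (form_value M p U (d i) w)) \<in> tensor_relations \<XX> M p"
proof -
  have U: "is_open \<XX> U" and e: "\<And>i. i < n \<Longrightarrow> e i \<in> carrier (msec M U)"
    using assms(1) by (auto simp: frame_on_def)
  have single: "Poly_Mapping.single (V, s) a
      - (\<Sum>i<n. Poly_Mapping.single (U, e i) (a * snd p (V \<inter> U) (d i (V \<inter> U) (mres M V (V \<inter> U) s))))
      \<in> tensor_relations \<XX> M p" (is "_ - ?r \<in> ?R")
    if V: "is_open \<XX> V" "fst p \<in> V" "s \<in> carrier (msec M V)" for V s a
  proof -
    define W where "W = V \<inter> U"
    have W: "is_open \<XX> W" "fst p \<in> W" "W \<subseteq> V" "W \<subseteq> U"
      using V U assms(2) by (auto simp: W_def)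
    interpret W: Module.module "sec \<XX> W" "msec M W" by (rule msec_module) fact
    let ?s = "mres M V W s" and ?e = "\<lambda>i. mres M U W (e i)"
    have eW: "?e i \<in> carrier (msec M W)" if "i < n" for i
      using mres_closed W U e that by auto
    have s: "?s \<in> carrier (msec M W)" using mres_closed V W by auto
    have dW: "d i W ?s \<in> carrier (sec \<XX> W)" if "i < n" for i
      by (rule form_mem[OF d[OF that]]) (use W s in auto)
    have 1: "Poly_Mapping.single (V, s) a - Poly_Mapping.single (W, ?s) a \<in> ?R"
      by (rule tensor_relations.germ) (use V W in auto)
    have "Poly_Mapping.single (W, \<Oplus>\<^bsub>msec M W\<^esub>i\<in>{..<n}. d i W ?s \<odot>\<^bsub>msec M W\<^esub> ?e i) a
        - (\<Sum>i<n. Poly_Mapping.single (W, d i W ?s \<odot>\<^bsub>msec M W\<^esub> ?e i) a) \<in> ?R"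
      by (rule single_finsum_relation) (use W eW dW W.M.abelian_monoid_axioms in auto)
    then have 2: "Poly_Mapping.single (W, ?s) a
        - (\<Sum>i<n. Poly_Mapping.single (W, d i W ?s \<odot>\<^bsub>msec M W\<^esub> ?e i) a) \<in> ?R"
      using dec[OF W(1,4) s] by simp
    have "(\<Sum>i<n. Poly_Mapping.single (W, d i W ?s \<odot>\<^bsub>msec M W\<^esub> ?e i) a
        - Poly_Mapping.single (U, e i) (a * snd p W (d i W ?s))) \<in> ?R"
    proof (rule tensor_relations_sum)
      fix i assume "i \<in> {..<n}"
      then have i: "i < n" by simp
      have "Poly_Mapping.single (W, d i W ?s \<odot>\<^bsub>msec M W\<^esub> ?e i) a
          - Poly_Mapping.single (W, ?e i) (a * snd p W (d i W ?s)) \<in> ?R"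
        by (rule tensor_relations.balanced) (use W eW dW i in auto)
      \<comment> \<open>The germ relation is used in reverse here: it carries the frame section from
        \<open>W\<close> back to \<open>U\<close>, so that the result is expressed in the same
        generators for every \<open>W\<close>.\<close>
      moreover have "Poly_Mapping.single (U, e i) (a * snd p W (d i W ?s))
          - Poly_Mapping.single (W, ?e i) (a * snd p W (d i W ?s)) \<in> ?R"
        by (rule tensor_relations.germ) (use W U e i in auto)
      ultimately show "Poly_Mapping.single (W, d i W ?s \<odot>\<^bsub>msec M W\<^esub> ?e i) a
          - Poly_Mapping.single (U, e i) (a * snd p W (d i W ?s)) \<in> ?R"
        using tensor_relations_diff by fastforce
    qed
    then have 3: "(\<Sum>i<n. Poly_Mapping.single (W, d i W ?s \<odot>\<^bsub>msec M W\<^esub> ?e i) a)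
        - (\<Sum>i<n. Poly_Mapping.single (U, e i) (a * snd p W (d i W ?s))) \<in> ?R"
      by (simp add: sum_subtractf)
    show ?thesis
      using tensor_relations_trans[OF 1 tensor_relations_trans[OF 2 3]] by (simp add: W_def)
  qed
  have "w - (\<Sum>i<n. Poly_Mapping.single (U, e i) (form_value M p U (d i) w))
    = (\<Sum>g\<in>Poly_Mapping.keys w. Poly_Mapping.single g (Poly_Mapping.lookup w g)
      - (\<Sum>i<n. Poly_Mapping.single (U, e i) (Poly_Mapping.lookup w g *
          snd p (fst g \<inter> U) (d i (fst g \<inter> U) (mres M (fst g) (fst g \<inter> U) (snd g))))))"
  proof -
    have "single' (form_value M p U (d i) w) = (\<Sum>g\<in>Poly_Mapping.keys w. single' (Poly_Mapping.lookup w g *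
          snd p (fst g \<inter> U) (d i (fst g \<inter> U) (mres M (fst g) (fst g \<inter> U) (snd g)))))"
      if "single' = Poly_Mapping.single (U, e i)" for i single'
      unfolding that form_value_def lin_ext_def case_prod_beta
      by (induction rule: infinite_finite_induct) (auto simp: single_add)
    then show ?thesis
      by (simp add: sum_subtractf flip: poly_mapping_sum_singles) (rule sum.swap)
  qed
  also have "\<dots> \<in> tensor_relations \<XX> M p"
  proof (rule tensor_relations_sum)
    fix g assume "g \<in> Poly_Mapping.keys w"
    with w have "is_open \<XX> (fst g)" "fst p \<in> fst g" "snd g \<in> carrier (msec M (fst g))"
      by (auto simp: fsums_def)
    from single[OF this, of "Poly_Mapping.lookup w g"]
    show "Poly_Mapping.single g (Poly_Mapping.lookup w g)
      - (\<Sum>i<n. Poly_Mapping.single (U, e i) (Poly_Mapping.lookup w g *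
          snd p (fst g \<inter> U) (d i (fst g \<inter> U) (mres M (fst g) (fst g \<inter> U) (snd g)))))
      \<in> tensor_relations \<XX> M p"
      by simp
  qed
  finally show ?thesis .
qed

end

section \<open>The line sheaf of a divisor\<close>

text \<open>The pairing of the fibre of \<open>O(D)\<close> at \<open>y\<close> with a section
  \<open>j\<close> of \<open>O(-D)\<close> over \<open>V\<close>. The left-hand side of
  \<open>transpose_maps_to\<close> is the case where \<open>j\<close> is the pull-back of some
  \<open>l(\<sigma>)\<close>; the local equation of \<open>D\<close> is the other choice of
  interest.\<close>

definition divisor_pairing ::
  "('q, 'b) ringed_space \<Rightarrow> ('q, 'b, 'f::field) geom_point \<Rightarrow> 'q set \<Rightarrow> 'b
    \<Rightarrow> ('q, 'q set \<Rightarrow> 'b \<Rightarrow> 'b, 'f) fsum \<Rightarrow> 'f alg_closure" where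
  "divisor_pairing Y y V j =
    lin_ext (\<lambda>(V', k). let W = V' \<inter> V in snd y W (k W (res Y V W j)))"

locale divisor = ringed Y for Y :: "('q, 'b) ringed_space" +
  fixes J :: "'q set \<Rightarrow> 'b set"
  assumes cartier: "effective_cartier_ideal Y J"
begin

abbreviation L where "L \<equiv> line_sheaf_of_divisor Y J"

lemma J_ideal: "is_open Y V \<Longrightarrow> ideal (J V) (sec Y V)"
  using cartier by (simp add: effective_cartier_ideal_def is_ideal_sheaf_def)

lemma J_subset: "is_open Y V \<Longrightarrow> j \<in> J V \<Longrightarrow> j \<in> carrier (sec Y V)"
  using J_ideal by (meson additive_subgroup.a_Hcarr ideal.axioms(1))

lemma J_add: "is_open Y V \<Longrightarrow> i \<in> J V \<Longrightarrow> j \<in> J V \<Longrightarrow> i \<oplus>\<^bsub>sec Y V\<^esub> j \<in> J V"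
  using J_ideal by (meson additive_subgroup.a_closed ideal.axioms(1))

lemma J_mult: "is_open Y V \<Longrightarrow> j \<in> J V \<Longrightarrow> a \<in> carrier (sec Y V) \<Longrightarrow> a \<otimes>\<^bsub>sec Y V\<^esub> j \<in> J V"
  using J_ideal by (meson ideal.I_l_closed)

lemma J_res:
  assumes "is_open Y V" "is_open Y W" "W \<subseteq> V" "j \<in> J V"
  shows "res Y V W j \<in> J W"
  by (rule funcset_mem[of "res Y V W" "J V"])
    (use cartier assms in \<open>simp_all add: effective_cartier_ideal_def is_ideal_sheaf_def sheaf_of_sets_def\<close>)

lemma msec_ideal_simps [simp]:
  "carrier (msec (ideal_as_module Y J) V) = J V"
  "add (msec (ideal_as_module Y J) V) = add (sec Y V)"
  "smult (msec (ideal_as_module Y J) V) = monoid.mult (sec Y V)"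
  "mres (ideal_as_module Y J) = res Y"
  by (simp_all add: ideal_as_module_def)

lemma carrier_L: "carrier (msec L V) = sheaf_forms Y (ideal_as_module Y J) V"
  by (simp add: line_sheaf_of_divisor_def dual_sheaf_def)

lemma mres_L: "mres L V W k = restrict k (opens_below Y W)"
  by (simp add: line_sheaf_of_divisor_def dual_sheaf_def)

lemma add_L: "k \<oplus>\<^bsub>msec L V\<^esub> l = (\<lambda>W\<in>opens_below Y V. \<lambda>j\<in>J W. k W j \<oplus>\<^bsub>sec Y W\<^esub> l W j)"
  by (simp add: line_sheaf_of_divisor_def dual_sheaf_def)

lemma smult_L: "a \<odot>\<^bsub>msec L V\<^esub> l = (\<lambda>W\<in>opens_below Y V. \<lambda>j\<in>J W. res Y V W a \<otimes>\<^bsub>sec Y W\<^esub> l W j)"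
  by (simp add: line_sheaf_of_divisor_def dual_sheaf_def)

lemma L_closed: "k \<in> carrier (msec L V) \<Longrightarrow> is_open Y W \<Longrightarrow> W \<subseteq> V \<Longrightarrow> j \<in> J W \<Longrightarrow> k W j \<in> carrier (sec Y W)"
  using form_mem[of k "ideal_as_module Y J" V W j] by (simp add: carrier_L)

lemma L_add: "k \<in> carrier (msec L V) \<Longrightarrow> is_open Y W \<Longrightarrow> W \<subseteq> V \<Longrightarrow> i \<in> J W \<Longrightarrow> j \<in> J W \<Longrightarrow>
    k W (i \<oplus>\<^bsub>sec Y W\<^esub> j) = k W i \<oplus>\<^bsub>sec Y W\<^esub> k W j"
  using form_add[of k "ideal_as_module Y J" V W i j] by (simp add: carrier_L)

lemma L_smult: "k \<in> carrier (msec L V) \<Longrightarrow> is_open Y W \<Longrightarrow> W \<subseteq> V \<Longrightarrow> a \<in> carrier (sec Y W) \<Longrightarrow> j \<in> J W \<Longrightarrow>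
    k W (a \<otimes>\<^bsub>sec Y W\<^esub> j) = a \<otimes>\<^bsub>sec Y W\<^esub> k W j"
  using form_smult[of k "ideal_as_module Y J" V W a j] by (simp add: carrier_L)

lemma L_res: "k \<in> carrier (msec L V) \<Longrightarrow> is_open Y W \<Longrightarrow> W \<subseteq> V \<Longrightarrow> is_open Y W' \<Longrightarrow> W' \<subseteq> W \<Longrightarrow> j \<in> J W \<Longrightarrow>
    res Y W W' (k W j) = k W' (res Y W W' j)"
  using form_res[of k "ideal_as_module Y J" V W W' j] by (simp add: carrier_L)

lemma canonical_section_closed: "canonical_section Y J \<in> carrier (msec L (pts Y))"
proof -
  have "W \<subseteq> pts Y" if "is_open Y W" for W
    using that by (rule openin_subset)
  then show ?thesis
    by (auto simp: carrier_L sheaf_forms_def canonical_section_def J_subset J_add J_mult J_res)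
qed

end

locale divisor_point = divisor Y J + ringed_point Y c y
  for Y :: "('q, 'b) ringed_space" and J :: "'q set \<Rightarrow> 'b set"
    and c :: "'f::field \<Rightarrow> 'b" and y :: "('q, 'b, 'f) geom_point"
begin

text \<open>Evaluation at \<open>y\<close> does not see the size of the neighbourhood, so values of
  a form computed over different open sets can be compared.\<close>

lemma ev_L_res:
  assumes "k \<in> carrier (msec L V)" "is_open Y W" "W \<subseteq> V" "is_open Y W'" "W' \<subseteq> W" "fst y \<in> W'" "j \<in> J W"
  shows "snd y W' (k W' (res Y W W' j)) = snd y W (k W j)"
  using assms by (simp add: ev_res L_closed flip: L_res)

text \<open>The counterpart of \<open>form_value_relation\<close> for \<open>O(D)\<close>. Linearity
  in the form is built into the pointwise operations of the dual sheaf, and the germ relation is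
  handled by \<open>ev_L_res\<close>.\<close>

lemma divisor_pairing_relation:
  assumes V: "is_open Y V" "fst y \<in> V" and j: "j \<in> J V" and r: "r \<in> tensor_relations Y L y"
  shows "divisor_pairing Y y V j r = 0"
  using r
proof (induction rule: tensor_relations.induct)
  case zero
  then show ?case by (simp add: divisor_pairing_def)
next
  case (plus r r')
  then show ?case by (simp add: divisor_pairing_def lin_ext_add)
next
  case (additive U k l a)
  then have W: "is_open Y (U \<inter> V)" "fst y \<in> U \<inter> V" using V by auto
  have "res Y V (U \<inter> V) j \<in> J (U \<inter> V)"
    by (rule J_res) (use V W j in auto)
  then show ?case
    using additive W by (simp add: divisor_pairing_def lin_ext_diff Let_def add_L ev_add L_closed distrib_left)
next
  case (balanced U k h a)
  then have W: "is_open Y (U \<inter> V)" "fst y \<in> U \<inter> V" using V by auto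
  have "res Y V (U \<inter> V) j \<in> J (U \<inter> V)"
    by (rule J_res) (use V W j in auto)
  then show ?case
    using balanced W by (simp add: divisor_pairing_def lin_ext_diff Let_def smult_L ev_mult ev_res res_closed L_closed)
next
  case (germ U U' k a)
  then have W: "is_open Y (U \<inter> V)" "is_open Y (U' \<inter> V)" "fst y \<in> U' \<inter> V" using V by auto
  have sub: "U' \<inter> V \<subseteq> U \<inter> V" using germ by auto
  have jU: "res Y V (U \<inter> V) j \<in> J (U \<inter> V)"
    by (rule J_res) (use V W j in auto)
  have "res Y V (U' \<inter> V) j = res Y (U \<inter> V) (U' \<inter> V) (res Y V (U \<inter> V) j)"
    by (rule res_res[symmetric]) (use V W j sub J_subset in auto)
  then have "snd y (U \<inter> V) (k (U \<inter> V) (res Y V (U \<inter> V) j))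
      = snd y (U' \<inter> V) (k (U' \<inter> V) (res Y V (U' \<inter> V) j))"
    using ev_L_res[OF germ(5) W(1) _ W(2) sub W(3) jU] by simp
  then show ?case
    using W by (simp add: divisor_pairing_def lin_ext_diff Let_def mres_L)
qed

text \<open>Division by a local equation \<open>g\<close> of \<open>D\<close> is a form
  \<open>h\<close> on \<open>O(-D)\<close>, and any form \<open>k\<close> satisfies
  \<open>k = k(g) h\<close> because every section of \<open>O(-D)\<close> is a multiple of
  \<open>g\<close>. Hence \<open>h\<close> spans the fibre, and the coordinate along it is the
  pairing with \<open>g\<close>.\<close>

lemma local_generator:
  obtains V g h where "is_open Y V" "fst y \<in> V" "g \<in> J V" "h \<in> carrier (msec L V)"
    "h V g = \<one>\<^bsub>sec Y V\<^esub>"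
    "\<And>u. u \<in> fsums Y L y \<Longrightarrow>
      u - Poly_Mapping.single (V, h) (divisor_pairing Y y V g u) \<in> tensor_relations Y L y"
proof -
  have "fst y \<in> pts Y"
    using point by (auto simp: geom_points_def)
  then obtain V g where V: "is_open Y V" "fst y \<in> V" and g: "g \<in> J V"
    and Vg: "\<forall>W\<in>opens_below Y V.
      J W = {a \<otimes>\<^bsub>sec Y W\<^esub> res Y V W g | a. a \<in> carrier (sec Y W)} \<and>
      (\<forall>a\<in>carrier (sec Y W). a \<otimes>\<^bsub>sec Y W\<^esub> res Y V W g = \<zero>\<^bsub>sec Y W\<^esub> \<longrightarrow> a = \<zero>\<^bsub>sec Y W\<^esub>)"
    using cartier unfolding effective_cartier_ideal_def by blast
  have gen: "J W = {a \<otimes>\<^bsub>sec Y W\<^esub> res Y V W g | a. a \<in> carrier (sec Y W)}"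
    and nzd: "a \<in> carrier (sec Y W) \<Longrightarrow> a \<otimes>\<^bsub>sec Y W\<^esub> res Y V W g = \<zero>\<^bsub>sec Y W\<^esub> \<Longrightarrow> a = \<zero>\<^bsub>sec Y W\<^esub>"
    if "is_open Y W" "W \<subseteq> V" for W a
    using bspec[OF Vg, of W] that by blast+
  have gW: "res Y V W g \<in> J W" if "is_open Y W" "W \<subseteq> V" for W
    using J_res V g that by blast
  \<comment> \<open>The quotient of \<open>j\<close> by \<open>g\<close>. It exists because
    \<open>g\<close> generates \<open>J W\<close>, and it is unique because \<open>g\<close> is a
    nonzerodivisor over every smaller open set.\<close>
  define q where "q W j = (THE a. a \<in> carrier (sec Y W) \<and> j = a \<otimes>\<^bsub>sec Y W\<^esub> res Y V W g)" for W j
  have q_eq: "q W (a \<otimes>\<^bsub>sec Y W\<^esub> res Y V W g) = a"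
    if W: "is_open Y W" "W \<subseteq> V" and a: "a \<in> carrier (sec Y W)" for W a
    unfolding q_def
  proof (rule the_equality)
    interpret cring "sec Y W" by (rule sec_cring) fact
    fix b assume b: "b \<in> carrier (sec Y W) \<and> a \<otimes>\<^bsub>sec Y W\<^esub> res Y V W g = b \<otimes>\<^bsub>sec Y W\<^esub> res Y V W g"
    have g': "res Y V W g \<in> carrier (sec Y W)" using gW W J_subset by blast
    have "(b \<ominus>\<^bsub>sec Y W\<^esub> a) \<otimes>\<^bsub>sec Y W\<^esub> res Y V W g
        = b \<otimes>\<^bsub>sec Y W\<^esub> res Y V W g \<ominus>\<^bsub>sec Y W\<^esub> a \<otimes>\<^bsub>sec Y W\<^esub> res Y V W g"
      using a b g' by algebra
    also have "\<dots> = \<zero>\<^bsub>sec Y W\<^esub>"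
      using a b g' by simp
    finally have "b \<ominus>\<^bsub>sec Y W\<^esub> a = \<zero>\<^bsub>sec Y W\<^esub>"
      using nzd W a b by auto
    then show "b = a" using a b by simp
  qed (use a in auto)
  have q: "q W j \<in> carrier (sec Y W)" "q W j \<otimes>\<^bsub>sec Y W\<^esub> res Y V W g = j"
    if W: "is_open Y W" "W \<subseteq> V" and j: "j \<in> J W" for W j
    using j q_eq[OF W] unfolding gen[OF W] by auto
  define h where "h = (\<lambda>W\<in>opens_below Y V. \<lambda>j\<in>J W. q W j)"
  have h_eq: "h W j = q W j" if "is_open Y W" "W \<subseteq> V" "j \<in> J W" for W j
    using that by (simp add: h_def)
  have q_add: "q W (i \<oplus>\<^bsub>sec Y W\<^esub> j) = q W i \<oplus>\<^bsub>sec Y W\<^esub> q W j"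
    if W: "is_open Y W" "W \<subseteq> V" and i: "i \<in> J W" and j: "j \<in> J W" for W i j
  proof -
    interpret cring "sec Y W" by (rule sec_cring) fact
    have "i \<oplus>\<^bsub>sec Y W\<^esub> j = (q W i \<oplus>\<^bsub>sec Y W\<^esub> q W j) \<otimes>\<^bsub>sec Y W\<^esub> res Y V W g"
      using q W i j gW[OF W] J_subset by (simp add: l_distr)
    then show ?thesis using q_eq[OF W] q[OF W] i j by simp
  qed
  have q_mult: "q W (a \<otimes>\<^bsub>sec Y W\<^esub> j) = a \<otimes>\<^bsub>sec Y W\<^esub> q W j"
    if W: "is_open Y W" "W \<subseteq> V" and a: "a \<in> carrier (sec Y W)" and j: "j \<in> J W" for W a j
  proof -
    interpret cring "sec Y W" by (rule sec_cring) fact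
    have "a \<otimes>\<^bsub>sec Y W\<^esub> j = (a \<otimes>\<^bsub>sec Y W\<^esub> q W j) \<otimes>\<^bsub>sec Y W\<^esub> res Y V W g"
      using q W a j gW[OF W] J_subset by (simp add: m_assoc)
    then show ?thesis using q_eq[OF W] q[OF W] a j by simp
  qed
  have q_res: "res Y W W' (q W j) = q W' (res Y W W' j)"
    if W: "is_open Y W" "W \<subseteq> V" and W': "is_open Y W'" "W' \<subseteq> W" and j: "j \<in> J W" for W W' j
  proof -
    have "res Y W W' j = res Y W W' (q W j \<otimes>\<^bsub>sec Y W\<^esub> res Y V W g)"
      using q W j by simp
    also have "\<dots> = res Y W W' (q W j) \<otimes>\<^bsub>sec Y W'\<^esub> res Y W W' (res Y V W g)"
      by (rule ring_hom_mult[OF res_hom]) (use W W' q(1) j gW J_subset in auto)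
    also have "res Y W W' (res Y V W g) = res Y V W' g"
      using res_res V W W' g J_subset by simp
    finally show ?thesis
      using q_eq[of W' "res Y W W' (q W j)"] W W' q j res_closed by simp
  qed
  have h: "h \<in> carrier (msec L V)"
    unfolding carrier_L sheaf_forms_def using q q_add q_mult q_res J_add J_mult J_res
    by (auto simp: h_def)
  have hg: "h V g = \<one>\<^bsub>sec Y V\<^esub>"
  proof -
    interpret cring "sec Y V" by (rule sec_cring) fact
    show ?thesis
      using q_eq[of V "\<one>\<^bsub>sec Y V\<^esub>"] h_eq[of V g] V g J_subset by (simp add: res_id)
  qed
  have single: "Poly_Mapping.single (U, k) a
      - Poly_Mapping.single (V, h) (a * snd y (U \<inter> V) (k (U \<inter> V) (res Y V (U \<inter> V) g)))
      \<in> tensor_relations Y L y" (is "_ \<in> ?R")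
    if U: "is_open Y U" "fst y \<in> U" and k: "k \<in> carrier (msec L U)" for U k a
  proof -
    define W where "W = U \<inter> V"
    have W: "is_open Y W" "fst y \<in> W" "W \<subseteq> U" "W \<subseteq> V"
      using U V by (auto simp: W_def)
    let ?b = "k W (res Y V W g)"
    have b: "?b \<in> carrier (sec Y W)"
      using L_closed[OF k] W gW by blast
    have hW: "mres L V W h \<in> carrier (msec L W)"
      unfolding carrier_L mres_L using h V W form_restrict by (simp add: carrier_L)
    \<comment> \<open>This is \<open>k = k(g) h\<close> over \<open>W\<close>: writing
      \<open>j\<close> as \<open>q W' j\<close> times \<open>g\<close> and pulling the quotient out
      of \<open>k\<close> leaves \<open>k(g)\<close> times \<open>h(j)\<close>.\<close>
    have "mres L U W k = ?b \<odot>\<^bsub>msec L W\<^esub> mres L V W h"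
      unfolding mres_L smult_L
    proof (rule restrict_ext)
      fix W' assume "W' \<in> opens_below Y W"
      then have W': "is_open Y W'" "W' \<subseteq> W" "W' \<subseteq> U" "W' \<subseteq> V" using W by auto
      interpret cring "sec Y W'" by (rule sec_cring) fact
      have kW': "k W' \<in> extensional (J W')"
        using k W' unfolding carrier_L sheaf_forms_def PiE_def by auto
      have "k W' j = res Y W W' ?b \<otimes>\<^bsub>sec Y W'\<^esub> h W' j" if j: "j \<in> J W'" for j
      proof -
        have "k W' j = k W' (q W' j \<otimes>\<^bsub>sec Y W'\<^esub> res Y V W' g)"
          using q W' j by simp
        also have "\<dots> = q W' j \<otimes>\<^bsub>sec Y W'\<^esub> k W' (res Y V W' g)"
          by (rule L_smult[OF k]) (use q W' j gW in auto)
        also have "res Y V W' g = res Y W W' (res Y V W g)"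
          using res_res V W W' g J_subset by simp
        also have "k W' \<dots> = res Y W W' ?b"
          using L_res[OF k] W W' gW by simp
        also have "q W' j \<otimes>\<^bsub>sec Y W'\<^esub> \<dots> = res Y W W' ?b \<otimes>\<^bsub>sec Y W'\<^esub> h W' j"
          using h_eq W' j q res_closed W b by (simp add: m_comm)
        finally show ?thesis .
      qed
      then show "k W' = (\<lambda>j\<in>J W'. res Y W W' ?b \<otimes>\<^bsub>sec Y W'\<^esub> restrict h (opens_below Y W) W' j)"
        using kW' \<open>W' \<in> opens_below Y W\<close> by (intro extensionalityI[of _ "J W'"]) auto
    qed
    moreover have "Poly_Mapping.single (U, k) a - Poly_Mapping.single (W, mres L U W k) a \<in> ?R"
      by (rule tensor_relations.germ) (use U W k in auto)
    moreover have "Poly_Mapping.single (W, ?b \<odot>\<^bsub>msec L W\<^esub> mres L V W h) a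
        - Poly_Mapping.single (W, mres L V W h) (a * snd y W ?b) \<in> ?R"
      by (rule tensor_relations.balanced) (use W hW b in auto)
    ultimately have "Poly_Mapping.single (U, k) a - Poly_Mapping.single (W, mres L V W h) (a * snd y W ?b) \<in> ?R"
      using tensor_relations_trans by metis
    \<comment> \<open>As for frames, the germ relation in reverse returns from \<open>W\<close> to
      the fixed open set \<open>V\<close>.\<close>
    moreover have "Poly_Mapping.single (V, h) (a * snd y W ?b)
        - Poly_Mapping.single (W, mres L V W h) (a * snd y W ?b) \<in> ?R"
      by (rule tensor_relations.germ) (use V W h in auto)
    ultimately show ?thesis
      using tensor_relations_diff unfolding W_def by fastforce
  qed
  have "u - Poly_Mapping.single (V, h) (divisor_pairing Y y V g u) \<in> tensor_relations Y L y"
    if u: "u \<in> fsums Y L y" for u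
  proof -
    let ?b = "\<lambda>x. snd y (fst x \<inter> V) (snd x (fst x \<inter> V) (res Y V (fst x \<inter> V) g))"
    have "Poly_Mapping.single (V, h) (divisor_pairing Y y V g u)
      = (\<Sum>x\<in>Poly_Mapping.keys u. Poly_Mapping.single (V, h) (Poly_Mapping.lookup u x * ?b x))"
      unfolding divisor_pairing_def lin_ext_def case_prod_beta Let_def
      by (induction rule: infinite_finite_induct) (auto simp: single_add)
    then have "u - Poly_Mapping.single (V, h) (divisor_pairing Y y V g u)
      = (\<Sum>x\<in>Poly_Mapping.keys u. Poly_Mapping.single x (Poly_Mapping.lookup u x)
          - Poly_Mapping.single (V, h) (Poly_Mapping.lookup u x * ?b x))"
      by (simp add: sum_subtractf flip: poly_mapping_sum_singles)
    also have "\<dots> \<in> tensor_relations Y L y"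
    proof (rule tensor_relations_sum)
      fix x assume "x \<in> Poly_Mapping.keys u"
      with u have "is_open Y (fst x)" "fst y \<in> fst x" "snd x \<in> carrier (msec L (fst x))"
        by (auto simp: fsums_def)
      from single[OF this, of "Poly_Mapping.lookup u x"]
      show "Poly_Mapping.single x (Poly_Mapping.lookup u x)
          - Poly_Mapping.single (V, h) (Poly_Mapping.lookup u x * ?b x) \<in> tensor_relations Y L y"
        by simp
    qed
    finally show ?thesis .
  qed
  with V g h hg show thesis by (rule that)
qed

end

section \<open>The transpose of evaluation at the section\<close>

lemma lin_ext_combination:
  "lin_ext (\<lambda>g. \<Sum>i\<in>A. c i * b i g) t = (\<Sum>i\<in>A. c i * lin_ext (b i) t)"
  unfolding lin_ext_def sum_distrib_left
  by (subst sum.swap) (simp add: mult.left_commute)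

locale pulled_zero_section = X: ringed_module \<XX> E + Y: divisor Y J
  for \<XX> :: "('p, 'a) ringed_space" and E :: "('p, 'a, 'm) module_sheaf"
    and Y :: "('q, 'b) ringed_space" and J :: "'q set \<Rightarrow> 'b set" +
  fixes \<pi> :: "('q, 'b, 'p, 'a) morphism" and I :: "'p set \<Rightarrow> 'a set" and \<sigma> :: 'm
    and c :: "'f::field \<Rightarrow> 'a"
  assumes morphism: "is_morphism Y \<XX> \<pi>"
    and structure_map: "structure_map \<XX> c"
    and ideal_sheaf: "is_ideal_sheaf \<XX> I"
    and J_eq: "J = inverse_image_ideal \<XX> I Y \<pi>"
    and locally_free: "locally_free_of_finite_rank \<XX> E"
    and section_closed: "\<sigma> \<in> carrier (msec E (pts \<XX>))"
    and zero_scheme: "\<And>U. is_open \<XX> U \<Longrightarrow> zero_scheme_ideal \<XX> E \<sigma> U = I U"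
begin

abbreviation P where "P \<equiv> preim Y \<pi>"

abbreviation c\<^sub>Y where "c\<^sub>Y \<equiv> pulled_back_structure \<XX> c \<pi>"

abbreviation push where "push \<equiv> push_point \<XX> Y \<pi>"

abbreviation \<sigma>_on where "\<sigma>_on U \<equiv> mres E (pts \<XX>) U \<sigma>"

lemma preim_open: "is_open \<XX> U \<Longrightarrow> is_open Y (P U)"
  using morphism by (auto simp: is_morphism_def preim_def intro: openin_continuous_map_preimage)

lemma preim_pts: "P (pts \<XX>) = pts Y"
  using morphism by (auto simp: is_morphism_def preim_def continuous_map_def)

lemma pull_hom: "is_open \<XX> U \<Longrightarrow> pull \<pi> U \<in> ring_hom (sec \<XX> U) (sec Y (P U))"
  using morphism by (simp add: is_morphism_def)

lemma pull_closed: "is_open \<XX> U \<Longrightarrow> s \<in> carrier (sec \<XX> U) \<Longrightarrow> pull \<pi> U s \<in> carrier (sec Y (P U))"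
  using pull_hom by (blast intro: ring_hom_closed)

lemma pull_res:
  "is_open \<XX> U \<Longrightarrow> is_open \<XX> V \<Longrightarrow> V \<subseteq> U \<Longrightarrow> s \<in> carrier (sec \<XX> U) \<Longrightarrow>
    res Y (P U) (P V) (pull \<pi> U s) = pull \<pi> V (res \<XX> U V s)"
  using morphism by (simp add: is_morphism_def)

lemma section_on_closed: "is_open \<XX> U \<Longrightarrow> \<sigma>_on U \<in> carrier (msec E U)"
  using X.mres_closed section_closed openin_subset by (metis openin_topspace)

lemma I_ideal: "is_open \<XX> U \<Longrightarrow> ideal (I U) (sec \<XX> U)"
  using ideal_sheaf by (simp add: is_ideal_sheaf_def)

lemma I_subset: "is_open \<XX> U \<Longrightarrow> s \<in> I U \<Longrightarrow> s \<in> carrier (sec \<XX> U)"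
  using I_ideal by (meson additive_subgroup.a_Hcarr ideal.axioms(1))

text \<open>The zero scheme condition is local; here \<open>U\<close> itself, with the form
  \<open>l\<close>, is the required neighbourhood of each of its points.\<close>

lemma form_section_in_I:
  assumes "is_open \<XX> U" "l \<in> sheaf_forms \<XX> E U"
  shows "l U (\<sigma>_on U) \<in> I U"
proof -
  have "l U (\<sigma>_on U) \<in> carrier (sec \<XX> U)"
    by (rule X.form_mem[OF assms(2)]) (use assms section_on_closed in auto)
  then have "l U (\<sigma>_on U) \<in> zero_scheme_ideal \<XX> E \<sigma> U"
    using assms X.res_id unfolding zero_scheme_ideal_def by auto
  then show ?thesis
    using assms zero_scheme by simp
qed

text \<open>The pull-back is one of the generators of the inverse image ideal over the whole of
  \<open>P U\<close>, so \<open>P U\<close> serves as the neighbourhood at every point.\<close>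

lemma pull_I:
  assumes U: "is_open \<XX> U" and s: "s \<in> I U"
  shows "pull \<pi> U s \<in> J (P U)"
proof -
  let ?S = "{res Y (P U') (P U) (pull \<pi> U' s) | U' s. is_open \<XX> U' \<and> P U \<subseteq> P U' \<and> s \<in> I U'}"
  have PU: "is_open Y (P U)" by (rule preim_open) fact
  interpret cring "sec Y (P U)" by (rule Y.sec_cring) fact
  have S: "?S \<subseteq> carrier (sec Y (P U))"
    using PU preim_open Y.res_closed pull_closed I_subset by auto
  have closed: "pull \<pi> U s \<in> carrier (sec Y (P U))"
    using pull_closed I_subset U s by blast
  have "res Y (P U) (P U) (pull \<pi> U s) \<in> ?S"
    using U s by blast
  with S have "res Y (P U) (P U) (pull \<pi> U s) \<in> Idl\<^bsub>sec Y (P U)\<^esub> ?S"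
    using genideal_self by blast
  then show ?thesis
    using PU closed unfolding J_eq inverse_image_ideal_def by blast
qed

lemma fst_push [simp]: "fst (push y) = pmap \<pi> (fst y)"
  by (simp add: push_point_def)

lemma snd_push:
  fixes y :: "('q, 'b, 'f) geom_point"
  shows "is_open \<XX> U \<Longrightarrow> pmap \<pi> (fst y) \<in> U \<Longrightarrow> s \<in> carrier (sec \<XX> U) \<Longrightarrow>
    snd (push y) U s = snd y (P U) (pull \<pi> U s)"
  by (simp add: push_point_def)

text \<open>Writes both sides as pairings, so that the facts on vanishing on relations become
  applicable.\<close>

lemma transpose_maps_to_iff:
  "transpose_maps_to \<XX> E \<sigma> Y \<pi> y u w \<longleftrightarrow>
    (\<forall>U l. is_open \<XX> U \<and> pmap \<pi> (fst y) \<in> U \<and> l \<in> sheaf_forms \<XX> E U \<longrightarrow>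
      divisor_pairing Y y (P U) (pull \<pi> U (l U (\<sigma>_on U))) u = form_value E (push y) U l w)"
  by (simp add: transpose_maps_to_def divisor_pairing_def form_value_def)

lemma transpose_zero: "transpose_maps_to \<XX> E \<sigma> Y \<pi> y 0 0"
  by (simp add: transpose_maps_to_iff divisor_pairing_def form_value_def)

lemma transpose_add:
  "transpose_maps_to \<XX> E \<sigma> Y \<pi> y u w \<Longrightarrow> transpose_maps_to \<XX> E \<sigma> Y \<pi> y u' w' \<Longrightarrow>
    transpose_maps_to \<XX> E \<sigma> Y \<pi> y (u + u') (w + w')"
  by (simp add: transpose_maps_to_iff divisor_pairing_def form_value_def lin_ext_add)

lemma transpose_scale:
  "transpose_maps_to \<XX> E \<sigma> Y \<pi> y u w \<Longrightarrow>
    transpose_maps_to \<XX> E \<sigma> Y \<pi> y (Poly_Mapping.map ((*) a) u) (Poly_Mapping.map ((*) a) w)"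
  by (simp add: transpose_maps_to_iff divisor_pairing_def form_value_def lin_ext_scale)

text \<open>Composition of the point, as a morphism from the spectrum of the algebraic closure to
  \<open>Y\<close>, with \<open>\<pi>\<close>. The structure map of \<open>Y\<close> is the pulled
  back one, so the scalars are respected.\<close>

lemma push_geom_points:
  assumes y: "y \<in> geom_points Y c\<^sub>Y"
  shows "push y \<in> geom_points \<XX> c"
proof -
  interpret y: ringed_point Y c\<^sub>Y y by unfold_locales fact
  let ?x = "pmap \<pi> (fst y)"
  have q: "fst y \<in> pts Y" using y by (auto simp: geom_points_def)
  then have x: "?x \<in> pts \<XX>"
    using preim_pts by (auto simp: preim_def)
  have in_preim: "fst y \<in> P U \<longleftrightarrow> ?x \<in> U" for U
    using q by (simp add: preim_def)
  have hom: "snd (push y) U \<in> ring_hom (sec \<XX> U) (ring_of_type_algebra :: 'f alg_closure ring)"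
    if U: "is_open \<XX> U" "?x \<in> U" for U
  proof -
    interpret cring "sec \<XX> U" by (rule X.sec_cring) fact
    have "snd y (P U) \<circ> pull \<pi> U \<in> ring_hom (sec \<XX> U) (ring_of_type_algebra :: 'f alg_closure ring)"
      by (rule ring_hom_trans) (use pull_hom y.ev_hom preim_open in_preim U in auto)
    then show ?thesis
      by (rule ring_hom_restrict) (use U snd_push in auto)
  qed
  have ext: "snd (push y) U \<in> extensional (carrier (sec \<XX> U))" if "is_open \<XX> U" "?x \<in> U" for U
    using that by (simp add: push_point_def)
  have restr: "snd (push y) V (res \<XX> U V s) = snd (push y) U s"
    if "is_open \<XX> U" "?x \<in> U" "is_open \<XX> V" "?x \<in> V" "V \<subseteq> U" "s \<in> carrier (sec \<XX> U)" for U V s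
  proof -
    have "snd (push y) V (res \<XX> U V s) = snd y (P V) (res Y (P U) (P V) (pull \<pi> U s))"
      using that by (simp add: snd_push X.res_closed pull_res)
    also have "\<dots> = snd y (P U) (pull \<pi> U s)"
      by (rule y.ev_res) (use that in_preim preim_open pull_closed in \<open>auto simp: preim_def\<close>)
    finally show ?thesis
      using that by (simp add: snd_push)
  qed
  \<comment> \<open>Locality is used twice: that of the point \<open>y\<close> makes the pull-back
    of \<open>s\<close> a unit near \<open>fst y\<close>, and that of \<open>\<pi>\<close> on stalks
    transfers this to \<open>s\<close>.\<close>
  have local: "germ_unit \<XX> ?x U s"
    if U: "is_open \<XX> U" "?x \<in> U" and s: "s \<in> carrier (sec \<XX> U)" and "snd (push y) U s \<noteq> 0" for U s
  proof -
    have "snd y (P U) (pull \<pi> U s) \<noteq> 0"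
      using that by (simp add: snd_push)
    moreover have "fst y \<in> P U" "is_open Y (P U)"
      using U in_preim preim_open by auto
    ultimately have "germ_unit Y (fst y) (P U) (pull \<pi> U s)"
      using y pull_closed[OF U(1) s] by (auto simp: geom_points_def)
    then show ?thesis
      using morphism q U s unfolding is_morphism_def by blast
  qed
  have c: "c a \<in> carrier (sec \<XX> (pts \<XX>))" for a
    using structure_map ring_hom_closed[of c "ring_of_type_algebra :: 'f ring" _ a]
    by (simp add: structure_map_def ring_of_type_algebra_def)
  have scalars: "snd (push y) (pts \<XX>) (c a) = to_ac a" for a
  proof -
    have "snd y (pts Y) (c\<^sub>Y a) = to_ac a"
      using y by (auto simp: geom_points_def)
    then show ?thesis
      using x c by (simp add: snd_push preim_pts pulled_back_structure_def)
  qed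
  have "snd (push y) \<in> extensional {U. is_open \<XX> U \<and> ?x \<in> U}"
    by (simp add: push_point_def)
  then have "(?x, snd (push y)) \<in> geom_points \<XX> c"
    using x hom ext restr local scalars by (simp add: geom_points_def)
  then show ?thesis
    by (simp add: push_point_def)
qed

end

section \<open>The transpose on the fibre over a fixed point of \<open>Y\<close>\<close>

locale pulled_zero_section_point = pulled_zero_section \<XX> E Y J \<pi> I \<sigma> c
  for \<XX> :: "('p, 'a) ringed_space" and E :: "('p, 'a, 'm) module_sheaf"
    and Y :: "('q, 'b) ringed_space" and J :: "'q set \<Rightarrow> 'b set"
    and \<pi> :: "('q, 'b, 'p, 'a) morphism" and I :: "'p set \<Rightarrow> 'a set" and \<sigma> :: 'm
    and c :: "'f::field \<Rightarrow> 'a" +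
  fixes y :: "('q, 'b, 'f) geom_point"
  assumes y: "y \<in> geom_points Y (pulled_back_structure \<XX> c \<pi>)"
begin

sublocale Y: divisor_point Y J c\<^sub>Y y
  by unfold_locales (rule y)

sublocale X: ringed_module_point \<XX> E c "push y"
  by unfold_locales (rule push_geom_points[OF y])

lemma in_preim: "fst y \<in> P U \<longleftrightarrow> pmap \<pi> (fst y) \<in> U"
  using y by (auto simp: preim_def geom_points_def)

text \<open>Both sides restrict to the same value over \<open>V \<inter> P U'\<close>. This permits
  shrinking the open set of \<open>\<XX>\<close> on which a section of \<open>I\<close> is
  considered.\<close>

lemma L_pull_res:
  assumes k: "k \<in> carrier (msec Y.L V)" and V: "is_open Y V" "fst y \<in> V"
    and U: "is_open \<XX> U" and U': "is_open \<XX> U'" "U' \<subseteq> U" "pmap \<pi> (fst y) \<in> U'" and s: "s \<in> I U"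
  shows "snd y (V \<inter> P U) (k (V \<inter> P U) (res Y (P U) (V \<inter> P U) (pull \<pi> U s)))
    = snd y (V \<inter> P U') (k (V \<inter> P U') (res Y (P U') (V \<inter> P U') (pull \<pi> U' (res \<XX> U U' s))))"
proof -
  have PU: "is_open Y (P U)" "is_open Y (P U')" "P U' \<subseteq> P U" "fst y \<in> P U'"
    using preim_open U U' in_preim by (auto simp: preim_def)
  then have W: "is_open Y (V \<inter> P U)" "is_open Y (V \<inter> P U')" "V \<inter> P U' \<subseteq> V \<inter> P U"
    using V by auto
  have s': "s \<in> carrier (sec \<XX> U)" using I_subset U s by blast
  have j: "res Y (P U) (V \<inter> P U) (pull \<pi> U s) \<in> J (V \<inter> P U)"
    by (rule Y.J_res) (use PU W pull_I U s in auto)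
  have "res Y (P U') (V \<inter> P U') (pull \<pi> U' (res \<XX> U U' s))
    = res Y (P U') (V \<inter> P U') (res Y (P U) (P U') (pull \<pi> U s))"
    using pull_res U U' s' by simp
  also have "\<dots> = res Y (P U) (V \<inter> P U') (pull \<pi> U s)"
    by (rule Y.res_res) (use PU W pull_closed U s' in auto)
  also have "\<dots> = res Y (V \<inter> P U) (V \<inter> P U') (res Y (P U) (V \<inter> P U) (pull \<pi> U s))"
    by (rule Y.res_res[symmetric]) (use PU W pull_closed U s' in auto)
  finally show ?thesis
    using Y.ev_L_res[OF k W(1) _ W(2,3) _ j] V PU by simp
qed

text \<open>The central computation. Over \<open>U \<inter> U'\<close> one has
  \<open>l(\<sigma>)\<close> equal to the sum of the \<open>d i (\<sigma>) l(e i)\<close>; pulling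
  back, applying \<open>k\<close> and evaluating at \<open>y\<close> keeps the factors
  \<open>d i (\<sigma>)\<close> inside \<open>k\<close> and turns the factors \<open>l(e i)\<close>
  into scalars.\<close>

lemma L_section_expansion:
  assumes fr: "frame_on \<XX> E U n e" and xU: "pmap \<pi> (fst y) \<in> U"
    and d: "\<And>i. i < n \<Longrightarrow> d i \<in> sheaf_forms \<XX> E U"
    and dec: "\<And>V s. is_open \<XX> V \<Longrightarrow> V \<subseteq> U \<Longrightarrow> s \<in> carrier (msec E V) \<Longrightarrow>
      s = (\<Oplus>\<^bsub>msec E V\<^esub>i\<in>{..<n}. d i V s \<odot>\<^bsub>msec E V\<^esub> mres E U V (e i))"
    and U': "is_open \<XX> U'" "pmap \<pi> (fst y) \<in> U'" and l: "l \<in> sheaf_forms \<XX> E U'"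
    and V: "is_open Y V" "fst y \<in> V" and k: "k \<in> carrier (msec Y.L V)"
  shows "snd y (V \<inter> P U') (k (V \<inter> P U') (res Y (P U') (V \<inter> P U') (pull \<pi> U' (l U' (\<sigma>_on U')))))
    = (\<Sum>i<n. snd (push y) (U \<inter> U') (l (U \<inter> U') (mres E U (U \<inter> U') (e i)))
        * snd y (V \<inter> P U) (k (V \<inter> P U) (res Y (P U) (V \<inter> P U) (pull \<pi> U (d i U (\<sigma>_on U))))))"
proof -
  have U: "is_open \<XX> U" and e: "\<And>i. i < n \<Longrightarrow> e i \<in> carrier (msec E U)"
    using fr by (auto simp: frame_on_def)
  define T where "T = U \<inter> U'"
  have T: "is_open \<XX> T" "T \<subseteq> U" "T \<subseteq> U'" "pmap \<pi> (fst y) \<in> T"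
    using U U' xU by (auto simp: T_def)
  define W where "W = V \<inter> P T"
  have PT: "is_open Y (P T)" "fst y \<in> P T"
    using preim_open T in_preim by auto
  then have W: "is_open Y W" "W \<subseteq> V" "W \<subseteq> P T" "fst y \<in> W"
    using V by (auto simp: W_def)
  \<comment> \<open>Only sections of \<open>I T\<close> may be inserted here, since \<open>k\<close>
    accepts only sections of \<open>J\<close>. Additivity and linearity are therefore proved on
    \<open>I T\<close> alone.\<close>
  define \<phi> where "\<phi> s = snd y W (k W (res Y (P T) W (pull \<pi> T s)))" for s
  have jW: "res Y (P T) W (pull \<pi> T s) \<in> J W" if "s \<in> I T" for s
    by (rule Y.J_res) (use PT W pull_I T that in auto)
  have kW: "k W (res Y (P T) W (pull \<pi> T s)) \<in> carrier (sec Y W)" if "s \<in> I T" for s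
    using Y.L_closed k W jW that by blast
  interpret T: Module.module "sec \<XX> T" "msec E T" by (rule X.msec_module) (rule T)
  interpret IT: ideal "I T" "sec \<XX> T" by (rule I_ideal) (rule T)
  have IT: "s \<in> carrier (sec \<XX> T)" if "s \<in> I T" for s
    using that IT.a_Hcarr by blast
  note pull_T = pull_hom[OF T(1)] and res_W = Y.res_hom[OF PT(1) W(1,3)]
  have \<phi>_add: "\<phi> (s \<oplus>\<^bsub>sec \<XX> T\<^esub> t) = \<phi> s + \<phi> t" if st: "s \<in> I T" "t \<in> I T" for s t
  proof -
    have "res Y (P T) W (pull \<pi> T (s \<oplus>\<^bsub>sec \<XX> T\<^esub> t))
      = res Y (P T) W (pull \<pi> T s) \<oplus>\<^bsub>sec Y W\<^esub> res Y (P T) W (pull \<pi> T t)"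
      using ring_hom_add[OF pull_T] ring_hom_add[OF res_W] ring_hom_closed[OF pull_T] st IT by simp
    then show ?thesis
      using Y.L_add[OF k W(1,2) jW[OF st(1)] jW[OF st(2)]] Y.ev_add[OF W(1,4) kW[OF st(1)] kW[OF st(2)]]
      by (simp add: \<phi>_def)
  qed
  \<comment> \<open>The section of the ideal stands on the left because the products in the
    expansion of \<open>l(\<sigma>)\<close> have the form \<open>d i (\<sigma>)\<close> times
    \<open>l(e i)\<close>, with the first factor in \<open>I T\<close>.\<close>
  have \<phi>_mult: "\<phi> (s \<otimes>\<^bsub>sec \<XX> T\<^esub> a) = snd (push y) T a * \<phi> s"
    if s: "s \<in> I T" and a: "a \<in> carrier (sec \<XX> T)" for s a
  proof -
    have a': "pull \<pi> T a \<in> carrier (sec Y (P T))" "res Y (P T) W (pull \<pi> T a) \<in> carrier (sec Y W)"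
      using ring_hom_closed[OF pull_T] ring_hom_closed[OF res_W] a by auto
    have "s \<otimes>\<^bsub>sec \<XX> T\<^esub> a = a \<otimes>\<^bsub>sec \<XX> T\<^esub> s"
      using s a IT T.m_comm by blast
    moreover have "res Y (P T) W (pull \<pi> T (a \<otimes>\<^bsub>sec \<XX> T\<^esub> s))
      = res Y (P T) W (pull \<pi> T a) \<otimes>\<^bsub>sec Y W\<^esub> res Y (P T) W (pull \<pi> T s)"
      using ring_hom_mult[OF pull_T] ring_hom_mult[OF res_W] ring_hom_closed[OF pull_T] s a IT by simp
    ultimately have "\<phi> (s \<otimes>\<^bsub>sec \<XX> T\<^esub> a) = snd y W (res Y (P T) W (pull \<pi> T a)) * \<phi> s"
      using Y.L_smult[OF k W(1,2) a'(2) jW[OF s]] Y.ev_mult[OF W(1,4) a'(2) kW[OF s]]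
      by (simp add: \<phi>_def)
    also have "snd y W (res Y (P T) W (pull \<pi> T a)) = snd (push y) T a"
      using Y.ev_res[OF PT(1) W(1,4,3) a'(1)] snd_push T a by simp
    finally show ?thesis .
  qed
  let ?e = "\<lambda>i. mres E U T (e i)" and ?s = "\<lambda>i. d i T (\<sigma>_on T)"
  have \<sigma>T: "\<sigma>_on T \<in> carrier (msec E T)"
    by (rule section_on_closed) (rule T)
  have eT: "?e i \<in> carrier (msec E T)" "l T (?e i) \<in> carrier (sec \<XX> T)" if "i < n" for i
  proof -
    show "?e i \<in> carrier (msec E T)"
      by (rule X.mres_closed) (use U T e that in auto)
    then show "l T (?e i) \<in> carrier (sec \<XX> T)"
      by (intro X.form_mem[OF l]) (use T in auto)
  qed
  have mres_\<sigma>: "mres E A T (\<sigma>_on A) = \<sigma>_on T" if "is_open \<XX> A" "T \<subseteq> A" for A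
    by (rule X.mres_mres) (use that T section_closed openin_subset[OF that(1)] in auto)
  have s_res: "?s i = res \<XX> U T (d i U (\<sigma>_on U))" if "i < n" for i
    using X.form_res[OF d[OF that] U _ T(1,2) section_on_closed[OF U]] mres_\<sigma>[OF U T(2)] by simp
  have sI: "?s i \<in> I T" if "i < n" for i
  proof -
    have "restrict (d i) (opens_below \<XX> T) \<in> sheaf_forms \<XX> E T"
      by (rule X.form_restrict[OF d[OF that] T(1,2)])
    from form_section_in_I[OF T(1) this] show ?thesis
      using T by simp
  qed
  have sT: "?s i \<in> carrier (sec \<XX> T)" if "i < n" for i
    using sI IT that by blast
  have group_T: "abelian_group (sec \<XX> T)"
    by (rule ring.is_abelian_group) (rule cring.axioms(1)[OF X.sec_cring[OF T(1)]])
  have "l T (\<sigma>_on T) = l T (\<Oplus>\<^bsub>msec E T\<^esub>i\<in>{..<n}. ?s i \<odot>\<^bsub>msec E T\<^esub> ?e i)"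
    using dec[OF T(1,2) \<sigma>T] by simp
  also have "\<dots> = (\<Oplus>\<^bsub>sec \<XX> T\<^esub>i\<in>{..<n}. l T (?s i \<odot>\<^bsub>msec E T\<^esub> ?e i))"
    by (rule finsum_hom) (use T.M.abelian_monoid_axioms group_T X.form_mem[OF l T(1,3)]
        X.form_add[OF l T(1,3)] eT sT in auto)
  also have "\<dots> = (\<Oplus>\<^bsub>sec \<XX> T\<^esub>i\<in>{..<n}. ?s i \<otimes>\<^bsub>sec \<XX> T\<^esub> l T (?e i))"
    by (rule abelian_monoid.finsum_cong'[OF abelian_group.axioms(1)[OF group_T]]) (use X.form_smult[OF l T(1,3)] eT sT in auto)
  finally have l_\<sigma>: "l T (\<sigma>_on T) = (\<Oplus>\<^bsub>sec \<XX> T\<^esub>i\<in>{..<n}. ?s i \<otimes>\<^bsub>sec \<XX> T\<^esub> l T (?e i))" .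
  \<comment> \<open>Both sides of the claim are transported to the common open set \<open>T\<close>,
    where the expansion of \<open>l(\<sigma>)\<close> is available.\<close>
  have "snd y (V \<inter> P U') (k (V \<inter> P U') (res Y (P U') (V \<inter> P U') (pull \<pi> U' (l U' (\<sigma>_on U')))))
    = \<phi> (res \<XX> U' T (l U' (\<sigma>_on U')))"
    unfolding \<phi>_def W_def
    by (rule L_pull_res[OF k V U'(1) T(1,3,4)]) (rule form_section_in_I[OF U'(1) l])
  also have "res \<XX> U' T (l U' (\<sigma>_on U')) = l T (\<sigma>_on T)"
    using X.form_res[OF l U'(1) _ T(1,3) section_on_closed[OF U'(1)]] mres_\<sigma>[OF U'(1) T(3)] by simp
  also have "\<phi> (l T (\<sigma>_on T)) = (\<Sum>i<n. \<phi> (?s i \<otimes>\<^bsub>sec \<XX> T\<^esub> l T (?e i)))"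
    unfolding l_\<sigma>
    by (rule conjunct2[OF finsum_additive[of _ _ "I T"]])
      (use abelian_group.axioms(1)[OF group_T] \<phi>_add IT.a_subset IT.zero_closed IT.a_closed IT.I_r_closed sI eT in auto)
  also have "\<dots> = (\<Sum>i<n. snd (push y) T (l T (?e i)) * \<phi> (?s i))"
    by (rule sum.cong) (use \<phi>_mult sI eT in auto)
  also have "\<dots> = (\<Sum>i<n. snd (push y) T (l T (?e i))
        * snd y (V \<inter> P U) (k (V \<inter> P U) (res Y (P U) (V \<inter> P U) (pull \<pi> U (d i U (\<sigma>_on U))))))"
  proof (rule sum.cong[OF refl])
    fix i assume "i \<in> {..<n}"
    then have i: "i < n" by simp
    have "snd y (V \<inter> P U) (k (V \<inter> P U) (res Y (P U) (V \<inter> P U) (pull \<pi> U (d i U (\<sigma>_on U))))) = \<phi> (?s i)"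
      unfolding \<phi>_def W_def s_res[OF i]
      by (rule L_pull_res[OF k V U T(1,2,4)]) (rule form_section_in_I[OF U d[OF i]])
    then show "snd (push y) T (l T (?e i)) * \<phi> (?s i) = snd (push y) T (l T (?e i))
        * snd y (V \<inter> P U) (k (V \<inter> P U) (res Y (P U) (V \<inter> P U) (pull \<pi> U (d i U (\<sigma>_on U)))))"
      by simp
  qed
  finally show ?thesis
    unfolding T_def .
qed

text \<open>An explicit image of \<open>u\<close> in a frame, whose coordinates are the pairings of
  \<open>u\<close> with the pull-backs of the \<open>d i (\<sigma>)\<close>. That it is tested
  correctly by every local form follows by applying \<open>L_section_expansion\<close> to each
  generator of \<open>u\<close>. The explicit coordinates are needed again for continuity.\<close>

lemma transpose_of_frame:
  assumes fr: "frame_on \<XX> E U n e" and xU: "pmap \<pi> (fst y) \<in> U"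
    and d: "\<And>i. i < n \<Longrightarrow> d i \<in> sheaf_forms \<XX> E U"
    and dec: "\<And>V s. is_open \<XX> V \<Longrightarrow> V \<subseteq> U \<Longrightarrow> s \<in> carrier (msec E V) \<Longrightarrow>
      s = (\<Oplus>\<^bsub>msec E V\<^esub>i\<in>{..<n}. d i V s \<odot>\<^bsub>msec E V\<^esub> mres E U V (e i))"
    and u: "u \<in> fsums Y Y.L y"
  defines "w \<equiv> \<Sum>i<n. Poly_Mapping.single (U, e i)
      (divisor_pairing Y y (P U) (pull \<pi> U (d i U (\<sigma>_on U))) u)"
  shows "w \<in> fsums \<XX> E (push y)" "transpose_maps_to \<XX> E \<sigma> Y \<pi> y u w"
proof -
  have "is_open \<XX> U" "\<And>i. i < n \<Longrightarrow> e i \<in> carrier (msec E U)"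
    using fr by (auto simp: frame_on_def)
  then show "w \<in> fsums \<XX> E (push y)"
    unfolding w_def using xU by (intro fsums_sum fsums_single) auto
  show "transpose_maps_to \<XX> E \<sigma> Y \<pi> y u w"
    unfolding transpose_maps_to_iff
  proof (intro allI impI)
    fix U' l assume *: "is_open \<XX> U' \<and> pmap \<pi> (fst y) \<in> U' \<and> l \<in> sheaf_forms \<XX> E U'"
    have "divisor_pairing Y y (P U') (pull \<pi> U' (l U' (\<sigma>_on U'))) u =
      lin_ext (\<lambda>g. \<Sum>i<n. snd (push y) (U \<inter> U') (l (U \<inter> U') (mres E U (U \<inter> U') (e i)))
        * (case g of (V, k) \<Rightarrow> let W = V \<inter> P U in
            snd y W (k W (res Y (P U) W (pull \<pi> U (d i U (\<sigma>_on U))))))) u"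
      unfolding divisor_pairing_def
    proof (rule lin_ext_cong)
      fix g assume "g \<in> Poly_Mapping.keys u"
      with u have "is_open Y (fst g)" "fst y \<in> fst g" "snd g \<in> carrier (msec Y.L (fst g))"
        by (auto simp: fsums_def)
      with L_section_expansion[OF fr xU d dec, of U' l "fst g" "snd g"] *
      show "(case g of (V, k) \<Rightarrow> let W = V \<inter> P U' in
            snd y W (k W (res Y (P U') W (pull \<pi> U' (l U' (\<sigma>_on U'))))))
        = (\<Sum>i<n. snd (push y) (U \<inter> U') (l (U \<inter> U') (mres E U (U \<inter> U') (e i)))
        * (case g of (V, k) \<Rightarrow> let W = V \<inter> P U in
            snd y W (k W (res Y (P U) W (pull \<pi> U (d i U (\<sigma>_on U)))))))"
        by (simp add: Let_def case_prod_beta)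
    qed
    then show "divisor_pairing Y y (P U') (pull \<pi> U' (l U' (\<sigma>_on U'))) u = form_value E (push y) U' l w"
      by (simp add: lin_ext_combination w_def form_value_def lin_ext_sum divisor_pairing_def mult.commute)
  qed
qed

lemma frame_exists:
  obtains U n e d where "frame_on \<XX> E U n e" "pmap \<pi> (fst y) \<in> U"
    "\<And>i. i < n \<Longrightarrow> d i \<in> sheaf_forms \<XX> E U"
    "\<And>V s. is_open \<XX> V \<Longrightarrow> V \<subseteq> U \<Longrightarrow> s \<in> carrier (msec E V) \<Longrightarrow>
      s = (\<Oplus>\<^bsub>msec E V\<^esub>i\<in>{..<n}. d i V s \<odot>\<^bsub>msec E V\<^esub> mres E U V (e i))"
proof -
  have "pmap \<pi> (fst y) \<in> pts \<XX>"
    using push_geom_points[OF y] by (auto simp: geom_points_def push_point_def)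
  then obtain U n e where fr: "pmap \<pi> (fst y) \<in> U" "frame_on \<XX> E U n e"
    using locally_free unfolding locally_free_of_finite_rank_def by blast
  from X.frame_on_coordinates[OF fr(2)] obtain d where "\<And>i. i < n \<Longrightarrow> d i \<in> sheaf_forms \<XX> E U"
    "\<And>V s. is_open \<XX> V \<Longrightarrow> V \<subseteq> U \<Longrightarrow> s \<in> carrier (msec E V) \<Longrightarrow>
      s = (\<Oplus>\<^bsub>msec E V\<^esub>i\<in>{..<n}. d i V s \<odot>\<^bsub>msec E V\<^esub> mres E U V (e i))"
    by blast
  with fr show thesis using that by blast
qed

lemma transpose_exists:
  assumes "u \<in> fsums Y Y.L y"
  obtains w where "w \<in> fsums \<XX> E (push y)" "transpose_maps_to \<XX> E \<sigma> Y \<pi> y u w"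
proof -
  obtain U n e d where fr: "frame_on \<XX> E U n e" "pmap \<pi> (fst y) \<in> U"
    "\<And>i. i < n \<Longrightarrow> d i \<in> sheaf_forms \<XX> E U"
    "\<And>V s. is_open \<XX> V \<Longrightarrow> V \<subseteq> U \<Longrightarrow> s \<in> carrier (msec E V) \<Longrightarrow>
      s = (\<Oplus>\<^bsub>msec E V\<^esub>i\<in>{..<n}. d i V s \<odot>\<^bsub>msec E V\<^esub> mres E U V (e i))"
    by (rule frame_exists) blast
  from transpose_of_frame[OF fr assms] show thesis by (rule that)
qed

text \<open>Equivalent \<open>u\<close> and \<open>u'\<close> have the same pairings with the
  pull-backs of the \<open>d i (\<sigma>)\<close>. The transpose condition turns these into the
  coordinates of \<open>w\<close> and \<open>w'\<close>, which determine the classes by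
  \<open>frame_decomposition\<close>.\<close>

lemma transpose_unique:
  assumes u: "u \<in> fsums Y Y.L y" "u' \<in> fsums Y Y.L y" "fibre_class Y Y.L y u = fibre_class Y Y.L y u'"
    and w: "w \<in> fsums \<XX> E (push y)" "w' \<in> fsums \<XX> E (push y)"
    and t: "transpose_maps_to \<XX> E \<sigma> Y \<pi> y u w" "transpose_maps_to \<XX> E \<sigma> Y \<pi> y u' w'"
  shows "fibre_class \<XX> E (push y) w = fibre_class \<XX> E (push y) w'"
proof -
  obtain U n e d where fr: "frame_on \<XX> E U n e" "pmap \<pi> (fst y) \<in> U"
    and d: "\<And>i. i < n \<Longrightarrow> d i \<in> sheaf_forms \<XX> E U"
    and dec: "\<And>V s. is_open \<XX> V \<Longrightarrow> V \<subseteq> U \<Longrightarrow> s \<in> carrier (msec E V) \<Longrightarrow>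
      s = (\<Oplus>\<^bsub>msec E V\<^esub>i\<in>{..<n}. d i V s \<odot>\<^bsub>msec E V\<^esub> mres E U V (e i))"
    by (rule frame_exists) blast
  have U: "is_open \<XX> U" using fr by (simp add: frame_on_def)
  have r: "u - u' \<in> tensor_relations Y Y.L y"
    using fibre_class_eq_iff u by blast
  have "form_value E (push y) U (d i) w = form_value E (push y) U (d i) w'" if i: "i < n" for i
  proof -
    let ?j = "pull \<pi> U (d i U (\<sigma>_on U))"
    have "divisor_pairing Y y (P U) ?j (u - u') = 0"
      by (rule Y.divisor_pairing_relation)
        (use preim_open U in_preim fr pull_I form_section_in_I d[OF i] r in auto)
    then have "divisor_pairing Y y (P U) ?j u = divisor_pairing Y y (P U) ?j u'"
      by (simp add: divisor_pairing_def lin_ext_diff)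
    with t show ?thesis
      using U fr(2) d[OF i] by (auto simp: transpose_maps_to_iff)
  qed
  then have eq: "(\<Sum>i<n. Poly_Mapping.single (U, e i) (form_value E (push y) U (d i) w))
      = (\<Sum>i<n. Poly_Mapping.single (U, e i) (form_value E (push y) U (d i) w'))"
    by simp
  have fd: "v - (\<Sum>i<n. Poly_Mapping.single (U, e i) (form_value E (push y) U (d i) v))
      \<in> tensor_relations \<XX> E (push y)" if "v \<in> fsums \<XX> E (push y)" for v
    by (rule X.frame_decomposition[OF fr(1) _ d dec that]) (use fr in auto)
  have "w - w' \<in> tensor_relations \<XX> E (push y)"
    using tensor_relations_diff[OF fd[OF w(1)] fd[OF w(2)]] eq by simp
  then show ?thesis
    using fibre_class_eq_iff w by blast
qed

text \<open>The fibre of \<open>O(D)\<close> is spanned by \<open>h\<close>, so only the coordinate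
  \<open>\<gamma>\<close> of \<open>u\<close> along \<open>h\<close> has to vanish. This gives
  definiteness of the induced norm.\<close>

lemma transpose_inj:
  assumes u: "u \<in> fsums Y Y.L y" and w: "w \<in> tensor_relations \<XX> E (push y)"
    and t: "transpose_maps_to \<XX> E \<sigma> Y \<pi> y u w"
  shows "u \<in> tensor_relations Y Y.L y"
proof -
  obtain V g h where V: "is_open Y V" "fst y \<in> V" and g: "g \<in> J V" and h: "h \<in> carrier (msec Y.L V)"
    and hg: "h V g = \<one>\<^bsub>sec Y V\<^esub>"
    and gen: "\<And>u. u \<in> fsums Y Y.L y \<Longrightarrow>
      u - Poly_Mapping.single (V, h) (divisor_pairing Y y V g u) \<in> tensor_relations Y Y.L y"
    by (rule Y.local_generator) blast
  define \<gamma> where "\<gamma> = divisor_pairing Y y V g u"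
  note r = gen[OF u, folded \<gamma>_def]
  \<comment> \<open>As \<open>w\<close> is a relation, \<open>u\<close> pairs to zero with every
    pulled back \<open>l(\<sigma>)\<close>; replacing \<open>u\<close> by its multiple of
    \<open>h\<close> gives a product in the field.\<close>
  have \<gamma>: "\<gamma> * snd y (V \<inter> P U) (h (V \<inter> P U) (res Y (P U) (V \<inter> P U) (pull \<pi> U (l U (\<sigma>_on U))))) = 0"
    if U: "is_open \<XX> U" "pmap \<pi> (fst y) \<in> U" and l: "l \<in> sheaf_forms \<XX> E U" for U l
  proof -
    let ?j = "pull \<pi> U (l U (\<sigma>_on U))"
    have "divisor_pairing Y y (P U) ?j (u - Poly_Mapping.single (V, h) \<gamma>) = 0"
      by (rule Y.divisor_pairing_relation)
        (use preim_open U in_preim pull_I form_section_in_I l r in auto)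
    moreover have "divisor_pairing Y y (P U) ?j u = 0"
      using t U l X.form_value_relation[OF U(1) _ l w] by (simp add: transpose_maps_to_iff)
    ultimately show ?thesis
      by (simp add: divisor_pairing_def lin_ext_diff Let_def)
  qed
  have "\<gamma> = 0"
  proof (rule ccontr)
    assume "\<gamma> \<noteq> 0"
    with \<gamma> have ev0: "snd y (V \<inter> P U) (h (V \<inter> P U) (res Y (P U) (V \<inter> P U) (pull \<pi> U (l U (\<sigma>_on U))))) = 0"
      if "is_open \<XX> U" "pmap \<pi> (fst y) \<in> U" "l \<in> sheaf_forms \<XX> E U" for U l
      using that by auto
    obtain W where W: "is_open Y W" "W \<subseteq> V" "fst y \<in> W" and
      gW: "res Y V W g \<in> Idl\<^bsub>sec Y W\<^esub>
        {res Y (P U) W (pull \<pi> U s) | U s. is_open \<XX> U \<and> W \<subseteq> P U \<and> s \<in> I U}"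
      using g V unfolding J_eq inverse_image_ideal_def by blast
    interpret cring "sec Y W" by (rule Y.sec_cring) (rule W)
    interpret JW: ideal "J W" "sec Y W" by (rule Y.J_ideal) (rule W)
    \<comment> \<open>The sections of \<open>O(-D)\<close> on which \<open>h\<close> vanishes at
      \<open>y\<close>. Once \<open>K\<close> is an ideal containing the generators, minimality of
      \<open>Idl\<close> puts the local equation \<open>g\<close> into it, against
      \<open>h(g) = 1\<close>.\<close>
    define K where "K = {x \<in> J W. snd y W (h W x) = 0}"
    have hW: "h W x \<in> carrier (sec Y W)" if "x \<in> J W" for x
      by (rule Y.L_closed[OF h W(1,2) that])
    have "ideal K (sec Y W)"
    proof (rule idealI)
      have zero: "snd y W (h W \<zero>\<^bsub>sec Y W\<^esub>) = 0"
        using Y.L_add[OF h W(1,2) JW.zero_closed JW.zero_closed] Y.ev_add[OF W(1,3) hW hW, OF JW.zero_closed JW.zero_closed]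
        by (metis JW.zero_closed add_cancel_right_right l_zero zero_closed)
      have add: "x \<oplus>\<^bsub>sec Y W\<^esub> x' \<in> K" if "x \<in> K" "x' \<in> K" for x x'
        using that Y.L_add[OF h W(1,2)] Y.ev_add[OF W(1,3) hW hW] by (simp add: K_def)
      have lmult: "b \<otimes>\<^bsub>sec Y W\<^esub> x \<in> K" if "x \<in> K" "b \<in> carrier (sec Y W)" for x b
        using that Y.L_smult[OF h W(1,2)] Y.ev_mult[OF W(1,3) _ hW] JW.I_l_closed by (simp add: K_def)
      show "ring (sec Y W)" by (rule ring_axioms)
      show "subgroup K (add_monoid (sec Y W))"
      proof (rule add.subgroupI)
        show "K \<subseteq> carrier (sec Y W)" using JW.a_subset by (auto simp: K_def)
        have "\<zero>\<^bsub>sec Y W\<^esub> \<in> K" by (simp add: K_def zero)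
        then show "K \<noteq> {}" by blast
        show "x \<oplus>\<^bsub>sec Y W\<^esub> x' \<in> K" if "x \<in> K" "x' \<in> K" for x x' using add that by blast
        fix x assume x: "x \<in> K"
        then have "x \<in> carrier (sec Y W)" using JW.a_subset by (auto simp: K_def)
        \<comment> \<open>Negation is multiplication by minus one, so closure under negatives is a
          case of \<open>lmult\<close>.\<close>
        then have eq: "\<ominus>\<^bsub>sec Y W\<^esub> x = (\<ominus>\<^bsub>sec Y W\<^esub> \<one>\<^bsub>sec Y W\<^esub>) \<otimes>\<^bsub>sec Y W\<^esub> x"
          by (simp add: l_minus)
        show "\<ominus>\<^bsub>sec Y W\<^esub> x \<in> K"
          unfolding eq by (rule lmult) (use x in simp_all)
      qed
      fix x b assume x: "x \<in> K" "b \<in> carrier (sec Y W)"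
      show "b \<otimes>\<^bsub>sec Y W\<^esub> x \<in> K" using lmult x .
      have "x \<in> carrier (sec Y W)" using x JW.a_subset by (auto simp: K_def)
      then show "x \<otimes>\<^bsub>sec Y W\<^esub> b \<in> K" using lmult[OF x] x m_comm by simp
    qed
    moreover have "{res Y (P U) W (pull \<pi> U s) | U s. is_open \<XX> U \<and> W \<subseteq> P U \<and> s \<in> I U} \<subseteq> K"
    proof clarify
      fix U s assume U: "is_open \<XX> U" "W \<subseteq> P U" and s: "s \<in> I U"
      have xU: "pmap \<pi> (fst y) \<in> U" using U W in_preim by auto
      have "s \<in> zero_scheme_ideal \<XX> E \<sigma> U" using zero_scheme U s by simp
      \<comment> \<open>Near the image point a section of \<open>I\<close> is the value at
        \<open>\<sigma>\<close> of a single form, which is where \<open>ev0\<close> applies.\<close>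
      then obtain U' l where U': "is_open \<XX> U'" "U' \<subseteq> U" "pmap \<pi> (fst y) \<in> U'"
        and l: "l \<in> sheaf_forms \<XX> E U'" "res \<XX> U U' s = l U' (\<sigma>_on U')"
        using xU unfolding zero_scheme_ideal_def by blast
      have PU: "is_open Y (P U)" "fst y \<in> P U" using preim_open U in_preim xU by auto
      have VU: "is_open Y (V \<inter> P U)" "W \<subseteq> V \<inter> P U" using PU V W U by auto
      have j: "res Y (P U) (V \<inter> P U) (pull \<pi> U s) \<in> J (V \<inter> P U)"
        by (rule Y.J_res) (use PU VU pull_I U s in auto)
      have "res Y (P U) W (pull \<pi> U s) = res Y (V \<inter> P U) W (res Y (P U) (V \<inter> P U) (pull \<pi> U s))"
        by (rule Y.res_res[symmetric]) (use PU VU W pull_closed I_subset U s in auto)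
      then have "snd y W (h W (res Y (P U) W (pull \<pi> U s)))
          = snd y (V \<inter> P U) (h (V \<inter> P U) (res Y (P U) (V \<inter> P U) (pull \<pi> U s)))"
        using Y.ev_L_res[OF h VU(1) _ W(1) VU(2) W(3) j] by simp
      also have "\<dots> = 0"
        using L_pull_res[OF h V U(1) U' s] ev0[OF U'(1,3) l(1)] l(2) by simp
      finally show "res Y (P U) W (pull \<pi> U s) \<in> K"
        using Y.J_res PU W U pull_I s by (simp add: K_def)
    qed
    ultimately have "res Y V W g \<in> K"
      using gW genideal_minimal by blast
    then have "snd y V (h V g) = 0"
      using Y.ev_L_res[OF h V(1) _ W g] by (simp add: K_def)
    then show False
      using hg Y.ev_one V by simp
  qed
  with r show ?thesis by simp
qed

end

section \<open>Continuity and the induced metric\<close>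

lemma absolute_value_uminus:
  assumes "absolute_value v"
  shows "v (- a) = v a"
proof -
  have mult: "v (a * b) = v a * v b" and nonneg: "0 \<le> v a" and zero: "v a = 0 \<longleftrightarrow> a = 0" for a b
    using assms by (auto simp: absolute_value_def)
  \<comment> \<open>\<open>v 1\<close> is a nonzero idempotent, hence one; then
    \<open>v (- 1)\<close> is a nonnegative number with square one.\<close>
  have "v 1 * v 1 = v 1" by (metis mult mult_1)
  then have "v 1 = 1" using zero[of 1] by simp
  moreover have "v (- 1) * v (- 1) = v 1" by (metis mult minus_mult_minus mult_1)
  ultimately have "v (- 1) = 1"
    using nonneg[of "- 1"] by (metis abs_of_nonneg abs_square_eq_1 power2_eq_square)
  then show ?thesis using mult[of "- 1" a] by simp
qed

lemma absolute_value_metric: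
  assumes "absolute_value v"
  shows "Metric_space UNIV (\<lambda>a b. v (a - b))"
proof
  have tri: "v (a + b) \<le> v a + v b" and nonneg: "0 \<le> v a" and zero: "v a = 0 \<longleftrightarrow> a = 0" for a b
    using assms by (auto simp: absolute_value_def)
  show "0 \<le> v (a - b)" "v (a - b) = v (b - a)" "(v (a - b) = 0) = (a = b)" for a b
    using nonneg zero absolute_value_uminus[OF assms, of "a - b"] by auto
  show "v (a - d) \<le> v (a - b) + v (b - d)" for a b d
    using tri[of "a - b" "b - d"] by simp
qed

lemma topspace_valued_field_topology [simp]:
  "absolute_value v \<Longrightarrow> topspace (valued_field_topology v) = UNIV"
  by (simp add: valued_field_topology_def Metric_space.topspace_mtopology absolute_value_metric)

lemma continuous_map_valued_field:
  assumes "absolute_value v"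
  shows "continuous_map T (valued_field_topology v) f \<longleftrightarrow>
    (\<forall>x\<in>topspace T. \<forall>\<epsilon>>0. \<exists>U. openin T U \<and> x \<in> U \<and> (\<forall>x'\<in>U. v (f x - f x') < \<epsilon>))"
proof -
  interpret Metric_space UNIV "\<lambda>a b. v (a - b)" by (rule absolute_value_metric) fact
  show ?thesis
    by (simp add: valued_field_topology_def continuous_map_to_metric)
qed

lemma continuous_map_valued_field_add:
  assumes v: "absolute_value v"
    and f: "continuous_map T (valued_field_topology v) f" and g: "continuous_map T (valued_field_topology v) g"
  shows "continuous_map T (valued_field_topology v) (\<lambda>x. f x + g x)"
  unfolding continuous_map_valued_field[OF v]
proof (intro ballI allI impI)
  fix x and \<epsilon> :: real assume x: "x \<in> topspace T" and \<epsilon>: "\<epsilon> > 0"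
  obtain U where U: "openin T U" "x \<in> U" "\<And>x'. x' \<in> U \<Longrightarrow> v (f x - f x') < \<epsilon> / 2"
    using f x \<epsilon> unfolding continuous_map_valued_field[OF v] by (meson half_gt_zero)
  obtain U' where U': "openin T U'" "x \<in> U'" "\<And>x'. x' \<in> U' \<Longrightarrow> v (g x - g x') < \<epsilon> / 2"
    using g x \<epsilon> unfolding continuous_map_valued_field[OF v] by (meson half_gt_zero)
  have "v (f x + g x - (f x' + g x')) < \<epsilon>" if "x' \<in> U \<inter> U'" for x'
  proof -
    have "v (f x + g x - (f x' + g x')) \<le> v (f x - f x') + v (g x - g x')"
      using v unfolding absolute_value_def by (metis add_diff_add)
    with U(3)[of x'] U'(3)[of x'] that show ?thesis by simp
  qed
  then show "\<exists>U. openin T U \<and> x \<in> U \<and> (\<forall>x'\<in>U. v (f x + g x - (f x' + g x')) < \<epsilon>)"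
    using U U' by (intro exI[of _ "U \<inter> U'"]) auto
qed

lemma continuous_map_valued_field_mult:
  assumes v: "absolute_value v"
    and f: "continuous_map T (valued_field_topology v) f" and g: "continuous_map T (valued_field_topology v) g"
  shows "continuous_map T (valued_field_topology v) (\<lambda>x. f x * g x)"
  unfolding continuous_map_valued_field[OF v]
proof (intro ballI allI impI)
  fix x and \<epsilon> :: real assume x: "x \<in> topspace T" and \<epsilon>: "\<epsilon> > 0"
  have mult: "v (a * b) = v a * v b" and nonneg: "0 \<le> v a" and tri: "v (a + b) \<le> v a + v b" for a b
    using v by (auto simp: absolute_value_def)
  \<comment> \<open>The summand one makes \<open>C\<close> positive and, since
    \<open>\<delta> \<le> 1\<close>, makes \<open>C\<close> a bound for \<open>v (g x')\<close> at
    all nearby points as well.\<close>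
  define C where "C = v (f x) + v (g x) + 1"
  have C: "C > 0" "v (f x) \<le> C" "v (g x) + 1 \<le> C" using nonneg[of "f x"] nonneg[of "g x"] by (auto simp: C_def)
  define \<delta> where "\<delta> = min 1 (\<epsilon> / (2 * C))"
  have \<delta>: "\<delta> > 0" "\<delta> \<le> 1" "\<delta> * C \<le> \<epsilon> / 2"
    using \<epsilon> C by (auto simp: \<delta>_def min_def field_simps)
  obtain U where U: "openin T U" "x \<in> U" "\<And>x'. x' \<in> U \<Longrightarrow> v (f x - f x') < \<delta>"
    using f x \<delta> unfolding continuous_map_valued_field[OF v] by meson
  obtain U' where U': "openin T U'" "x \<in> U'" "\<And>x'. x' \<in> U' \<Longrightarrow> v (g x - g x') < \<delta>"
    using g x \<delta> unfolding continuous_map_valued_field[OF v] by meson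
  have "v (f x * g x - f x' * g x') < \<epsilon>" if x': "x' \<in> U \<inter> U'" for x'
  proof -
    have df: "v (f x - f x') < \<delta>" and dg: "v (g x - g x') < \<delta>"
      using U(3) U'(3) x' by auto
    have "v (g x') \<le> v (g x) + v (g x' - g x)"
      using tri[of "g x" "g x' - g x"] by simp
    moreover have "v (g x' - g x) = v (g x - g x')"
      using absolute_value_uminus[OF v, of "g x - g x'"] by simp
    ultimately have gC: "v (g x') \<le> C"
      using dg \<delta> C by linarith
    have "f x * g x - f x' * g x' = f x * (g x - g x') + (f x - f x') * g x'"
      by (simp add: algebra_simps)
    then have "v (f x * g x - f x' * g x') \<le> v (f x) * v (g x - g x') + v (f x - f x') * v (g x')"
      using tri mult by metis
    also have "\<dots> \<le> C * v (g x - g x') + v (f x - f x') * C"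
      using C gC nonneg by (intro add_mono mult_mono) auto
    also have "\<dots> < C * \<delta> + \<delta> * C"
      using C df dg by (intro add_strict_mono) auto
    also have "\<dots> \<le> \<epsilon>" using \<delta> by (simp add: mult.commute)
    finally show ?thesis .
  qed
  then show "\<exists>U. openin T U \<and> x \<in> U \<and> (\<forall>x'\<in>U. v (f x * g x - f x' * g x') < \<epsilon>)"
    using U U' by (intro exI[of _ "U \<inter> U'"]) auto
qed

lemma continuous_map_valued_field_sum:
  assumes v: "absolute_value v"
    and "\<And>i. i \<in> A \<Longrightarrow> continuous_map T (valued_field_topology v) (f i)"
  shows "continuous_map T (valued_field_topology v) (\<lambda>x. \<Sum>i\<in>A. f i x)"
  using assms(2)
proof (induction A rule: infinite_finite_induct)
  case (insert i A)
  have "continuous_map T (valued_field_topology v) (\<lambda>x. f i x + (\<Sum>i\<in>A. f i x))"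
    by (rule continuous_map_valued_field_add[OF v]) (use insert in auto)
  then show ?case
    using insert.hyps by simp
qed (use v in simp_all)

section \<open>Regular functions and the analytic topology\<close>

context ringed
begin

lemma openin_analytic:
  assumes "absolute_value v" "is_open \<XX> U" "s \<in> carrier (sec \<XX> U)" "openin (valued_field_topology v) B"
  shows "openin (analytic_topology v \<XX> c) {p \<in> geom_points \<XX> c. fst p \<in> U \<and> snd p U s \<in> B}"
  unfolding analytic_topology_def by (rule topology_generated_by_Basis) (use assms in blast)

lemma openin_analytic_points_over:
  assumes "absolute_value v" "is_open \<XX> U"
  shows "openin (analytic_topology v \<XX> c) {p \<in> geom_points \<XX> c. fst p \<in> U}"
proof -
  interpret cring "sec \<XX> U" by (rule sec_cring) fact
  have "openin (valued_field_topology v) UNIV"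
    using openin_topspace[of "valued_field_topology v"] assms(1) by simp
  \<comment> \<open>The zero section with the whole field as target imposes no condition beyond
    lying over \<open>U\<close>.\<close>
  from openin_analytic[OF assms zero_closed this] show ?thesis by simp
qed

lemma topspace_analytic:
  assumes "absolute_value v"
  shows "topspace (analytic_topology v \<XX> c) = geom_points \<XX> c"
proof
  show "topspace (analytic_topology v \<XX> c) \<subseteq> geom_points \<XX> c"
    unfolding analytic_topology_def topology_generated_by_topspace by blast
  have "{p \<in> geom_points \<XX> c. fst p \<in> pts \<XX>} \<subseteq> topspace (analytic_topology v \<XX> c)"
    by (rule openin_subset) (simp add: openin_analytic_points_over assms)
  then show "geom_points \<XX> c \<subseteq> topspace (analytic_topology v \<XX> c)"
    by (auto simp: geom_points_def)
qed

lemma continuous_map_ev: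
  assumes v: "absolute_value v" and U: "is_open \<XX> U" and s: "s \<in> carrier (sec \<XX> U)"
  shows "continuous_map (subtopology (analytic_topology v \<XX> c) {p. fst p \<in> U}) (valued_field_topology v)
    (\<lambda>p. snd p U s)"
  unfolding continuous_map
proof (intro conjI allI impI)
  fix B assume B: "openin (valued_field_topology v) B"
  have "{p \<in> topspace (subtopology (analytic_topology v \<XX> c) {p. fst p \<in> U}). snd p U s \<in> B}
    = {p \<in> geom_points \<XX> c. fst p \<in> U \<and> snd p U s \<in> B} \<inter> {p. fst p \<in> U}"
    by (auto simp: topspace_analytic v)
  with openin_analytic[OF v U s B]
  show "openin (subtopology (analytic_topology v \<XX> c) {p. fst p \<in> U})
      {p \<in> topspace (subtopology (analytic_topology v \<XX> c) {p. fst p \<in> U}). snd p U s \<in> B}"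
    by (auto simp: openin_subtopology)
qed (use v in simp)

end

section \<open>The metric on \<open>O(D)\<close> that makes the transpose isometric\<close>

context pulled_zero_section
begin

text \<open>The preimage of a generating open set is again a generating one, namely that of the
  pulled back function over the preimage of \<open>U\<close>.\<close>

lemma continuous_map_push:
  assumes v: "absolute_value v"
  shows "continuous_map (analytic_topology v Y c\<^sub>Y) (analytic_topology v \<XX> c) push"
proof -
  have top: "topspace (analytic_topology v Y c\<^sub>Y) = geom_points Y c\<^sub>Y"
    by (rule Y.topspace_analytic) fact
  show ?thesis
    unfolding analytic_topology_def[of v \<XX> c]
  proof (rule continuous_on_generated_topo)
    fix A assume "A \<in> {{p \<in> geom_points \<XX> c. fst p \<in> U \<and> snd p U s \<in> B} | U s B.
      is_open \<XX> U \<and> s \<in> carrier (sec \<XX> U) \<and> openin (valued_field_topology v) B}"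
    then obtain U s B where A: "A = {p \<in> geom_points \<XX> c. fst p \<in> U \<and> snd p U s \<in> B}"
      and U: "is_open \<XX> U" and s: "s \<in> carrier (sec \<XX> U)" and B: "openin (valued_field_topology v) B"
      by blast
    have "fst y \<in> P U \<longleftrightarrow> pmap \<pi> (fst y) \<in> U" if "y \<in> geom_points Y c\<^sub>Y" for y
      using that by (auto simp: preim_def geom_points_def)
    then have "push -` A \<inter> topspace (analytic_topology v Y c\<^sub>Y)
      = {y \<in> geom_points Y c\<^sub>Y. fst y \<in> P U \<and> snd y (P U) (pull \<pi> U s) \<in> B}"
      using push_geom_points by (auto simp: top A snd_push U s)
    then show "openin (analytic_topology v Y c\<^sub>Y) (push -` A \<inter> topspace (analytic_topology v Y c\<^sub>Y))"
      using Y.openin_analytic[OF v preim_open[OF U] pull_closed[OF U s] B] by simp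
  next
    show "push ` topspace (analytic_topology v Y c\<^sub>Y) \<subseteq> \<Union> {{p \<in> geom_points \<XX> c. fst p \<in> U \<and> snd p U s \<in> B} | U s B.
      is_open \<XX> U \<and> s \<in> carrier (sec \<XX> U) \<and> openin (valued_field_topology v) B}"
      using push_geom_points X.topspace_analytic[OF v, of c]
      unfolding top analytic_topology_def topology_generated_by_topspace by blast
  qed
qed

text \<open>The class \<open>A\<close> is sent to the norm of any transpose image of any of its
  representatives; \<open>transpose_unique\<close> shows that the choice is immaterial. The two
  bounded abstractions give the extensionality required of metrics, so that uniqueness can be stated
  as equality.\<close>

definition induced_metric ::
  "(('p, 'a, 'f) geom_point \<Rightarrow> ('p, 'm, 'f) fsum set \<Rightarrow> real)
    \<Rightarrow> ('q, 'b, 'f) geom_point \<Rightarrow> ('q, 'q set \<Rightarrow> 'b \<Rightarrow> 'b, 'f) fsum set \<Rightarrow> real" where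
  "induced_metric N = (\<lambda>y\<in>geom_points Y c\<^sub>Y. \<lambda>A\<in>fibre Y Y.L y.
    N (push y) (fibre_class \<XX> E (push y) (SOME w. w \<in> fsums \<XX> E (push y) \<and>
      (\<exists>u\<in>fsums Y Y.L y. A = fibre_class Y Y.L y u \<and> transpose_maps_to \<XX> E \<sigma> Y \<pi> y u w))))"

lemma point_locale:
  "y \<in> geom_points Y c\<^sub>Y \<Longrightarrow> pulled_zero_section_point \<XX> E Y J \<pi> I \<sigma> c y"
  by unfold_locales

text \<open>The vector picked by \<open>SOME\<close> belongs to a possibly different representative
  \<open>u'\<close> of the same class, and \<open>transpose_unique\<close> compares its image with
  the given \<open>w\<close>.\<close>

lemma induced_metric_eq:
  assumes y: "y \<in> geom_points Y c\<^sub>Y" and u: "u \<in> fsums Y Y.L y" and w: "w \<in> fsums \<XX> E (push y)"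
    and t: "transpose_maps_to \<XX> E \<sigma> Y \<pi> y u w"
  shows "induced_metric N y (fibre_class Y Y.L y u) = N (push y) (fibre_class \<XX> E (push y) w)"
proof -
  interpret pulled_zero_section_point \<XX> E Y J \<pi> I \<sigma> c y by (rule point_locale) fact
  let ?Q = "\<lambda>w. w \<in> fsums \<XX> E (push y) \<and> (\<exists>u'\<in>fsums Y Y.L y.
    fibre_class Y Y.L y u = fibre_class Y Y.L y u' \<and> transpose_maps_to \<XX> E \<sigma> Y \<pi> y u' w)"
  define w\<^sub>0 where "w\<^sub>0 = (SOME w. ?Q w)"
  have "?Q w\<^sub>0"
    unfolding w\<^sub>0_def by (rule someI[of ?Q w]) (use u w t in blast)
  then obtain u' where u': "u' \<in> fsums Y Y.L y" "fibre_class Y Y.L y u = fibre_class Y Y.L y u'"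
    and w\<^sub>0: "w\<^sub>0 \<in> fsums \<XX> E (push y)" "transpose_maps_to \<XX> E \<sigma> Y \<pi> y u' w\<^sub>0"
    by blast
  have "fibre_class \<XX> E (push y) w\<^sub>0 = fibre_class \<XX> E (push y) w"
    by (rule transpose_unique[OF u'(1) u u'(2)[symmetric] w\<^sub>0(1) w w\<^sub>0(2) t])
  moreover have "fibre_class Y Y.L y u \<in> fibre Y Y.L y"
    using u by (simp add: fibre_def)
  ultimately show ?thesis
    using y by (simp add: induced_metric_def w\<^sub>0_def)
qed

text \<open>Homogeneity and the triangle inequality are inherited because transpose images may be
  scaled and added. Definiteness is \<open>transpose_inj\<close> in one direction and
  \<open>transpose_unique\<close> in the other.\<close>

lemma induced_metric_fibre_norm:
  assumes y: "y \<in> geom_points Y c\<^sub>Y" and N: "fibre_norm v \<XX> E (push y) (N (push y))"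
  shows "fibre_norm v Y Y.L y (induced_metric N y)"
proof -
  interpret pulled_zero_section_point \<XX> E Y J \<pi> I \<sigma> c y by (rule point_locale) fact
  let ?N = "N (push y)" and ?N' = "induced_metric N y"
  let ?cX = "fibre_class \<XX> E (push y)" and ?cY = "fibre_class Y Y.L y"
  have nonneg: "0 \<le> ?N (?cX t)" and zero: "?N (?cX t) = 0 \<longleftrightarrow> ?cX t = ?cX 0"
    and scale: "?N (?cX (Poly_Mapping.map ((*) a) t)) = v a * ?N (?cX t)"
    if "t \<in> fsums \<XX> E (push y)" for a t
    using N that unfolding fibre_norm_def by blast+
  have tri: "?N (?cX (t + t')) \<le> ?N (?cX t) + ?N (?cX t')"
    if "t \<in> fsums \<XX> E (push y)" "t' \<in> fsums \<XX> E (push y)" for t t'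
    using N that unfolding fibre_norm_def by blast
  show ?thesis
    unfolding fibre_norm_def
  proof (intro conjI ballI allI)
    show "?N' \<in> extensional (fibre Y Y.L y)"
      using y by (simp add: induced_metric_def)
    fix t assume t: "t \<in> fsums Y Y.L y"
    obtain w where w: "w \<in> fsums \<XX> E (push y)" and tw: "transpose_maps_to \<XX> E \<sigma> Y \<pi> y t w"
      using transpose_exists[OF t] .
    have eq: "?N' (?cY t) = ?N (?cX w)"
      by (rule induced_metric_eq[OF y t w tw])
    show "0 \<le> ?N' (?cY t)" using eq nonneg[OF w] by simp
    show "?N' (?cY t) = 0 \<longleftrightarrow> ?cY t = ?cY 0"
    proof
      assume "?N' (?cY t) = 0"
      then have "?cX w = ?cX 0" using eq zero[OF w] by simp
      then have "w \<in> tensor_relations \<XX> E (push y)"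
        using fibre_class_eq_iff[OF w fsums_0] by simp
      then have "t \<in> tensor_relations Y Y.L y"
        by (rule transpose_inj[OF t _ tw])
      then show "?cY t = ?cY 0"
        using fibre_class_eq_iff[OF t fsums_0] by simp
    next
      assume "?cY t = ?cY 0"
      then have "?cX w = ?cX 0"
        by (rule transpose_unique[OF t fsums_0 _ w fsums_0 tw transpose_zero])
      then show "?N' (?cY t) = 0" using eq zero[OF w] by simp
    qed
    show "?N' (?cY (Poly_Mapping.map ((*) a) t)) = v a * ?N' (?cY t)" for a
      using induced_metric_eq[OF y fsums_scale[OF t] fsums_scale[OF w] transpose_scale[OF tw]] eq scale[OF w]
      by simp
    fix t' assume t': "t' \<in> fsums Y Y.L y"
    obtain w' where w': "w' \<in> fsums \<XX> E (push y)" and tw': "transpose_maps_to \<XX> E \<sigma> Y \<pi> y t' w'"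
      using transpose_exists[OF t'] .
    show "?N' (?cY (t + t')) \<le> ?N' (?cY t) + ?N' (?cY t')"
      using induced_metric_eq[OF y fsums_add[OF t t'] fsums_add[OF w w'] transpose_add[OF tw tw']]
        eq induced_metric_eq[OF y t' w' tw'] tri[OF w w'] by simp
  qed
qed

text \<open>Above an open set carrying a frame of \<open>E\<close>, the function factors as the
  continuous norm of \<open>E\<close> in that frame after the map sending a point and coefficients
  to the image point and the coordinates of the transpose. These coordinates are polynomial in the
  coefficients and regular functions.\<close>

lemma induced_metric_continuous:
  fixes n :: nat
  assumes v: "absolute_value v" and N: "metric_on v \<XX> c E N"
    and V: "is_open Y V" and s: "\<And>j. j < n \<Longrightarrow> s j \<in> carrier (msec Y.L V)"
  shows "continuous_map
    (prod_topology (subtopology (analytic_topology v Y c\<^sub>Y) {y. fst y \<in> V})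
      (product_topology (\<lambda>_. valued_field_topology v) {..<n}))
    euclideanreal
    (\<lambda>(y, a). induced_metric N y (fibre_class Y Y.L y (\<Sum>j<n. Poly_Mapping.single (V, s j) (a j))))"
    (is "continuous_map (prod_topology ?A ?B) _ ?F")
proof -
  let ?Z = "prod_topology ?A ?B"
  have topA: "topspace ?A = {y \<in> geom_points Y c\<^sub>Y. fst y \<in> V}"
    by (auto simp: Y.topspace_analytic v)
  have fst_cont: "continuous_map ?Z ?A fst" and snd_cont: "continuous_map ?Z ?B snd"
    by (simp_all add: continuous_map_fst continuous_map_snd)
  \<comment> \<open>The part of the total space lying above \<open>U\<close>; these sets cover it as
    \<open>U\<close> runs over the domains of frames.\<close>
  define T where "T U = {z \<in> topspace ?Z. fst z \<in> {y \<in> topspace ?A. fst y \<in> P U}}" for U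
  have Tmem: "fst z \<in> geom_points Y c\<^sub>Y" "fst (fst z) \<in> V" "fst (fst z) \<in> P U" if "z \<in> T U" for z U
    using that topA by (auto simp: T_def)
  show ?thesis
  \<comment> \<open>The pieces are indexed by frames but carry the same function, so agreement on
    overlaps is immediate.\<close>
  proof (rule pasting_lemma[where I = "{(U, m, e). frame_on \<XX> E U m e}" and T = "\<lambda>(U, m, e). T U"
        and f = "\<lambda>_. ?F"])
    fix i assume "i \<in> {(U, m, e). frame_on \<XX> E U m e}"
    then obtain U m e where i: "i = (U, m, e)" and fr: "frame_on \<XX> E U m e" by blast
    have U: "is_open \<XX> U" and e: "\<And>k. k < m \<Longrightarrow> e k \<in> carrier (msec E U)"
      using fr by (auto simp: frame_on_def)
    have PU: "is_open Y (P U)" by (rule preim_open) fact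
    have "{y \<in> topspace ?A. fst y \<in> P U} = {y \<in> geom_points Y c\<^sub>Y. fst y \<in> P U} \<inter> {y. fst y \<in> V}"
      using topA by auto
    then have "openin ?A {y \<in> topspace ?A. fst y \<in> P U}"
      using Y.openin_analytic_points_over[OF v PU] by (auto simp: openin_subtopology)
    then have "openin ?Z (T U)"
      unfolding T_def by (rule openin_continuous_map_preimage[OF fst_cont])
    then show "openin ?Z (case i of (U, m, e) \<Rightarrow> T U)" by (simp add: i)
    obtain d where d: "\<And>i. i < m \<Longrightarrow> d i \<in> sheaf_forms \<XX> E U"
      and dec: "\<And>V s. is_open \<XX> V \<Longrightarrow> V \<subseteq> U \<Longrightarrow> s \<in> carrier (msec E V) \<Longrightarrow>
        s = (\<Oplus>\<^bsub>msec E V\<^esub>i\<in>{..<m}. d i V s \<odot>\<^bsub>msec E V\<^esub> mres E U V (e i))"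
      using X.frame_on_coordinates[OF fr] by blast
    define W where "W = V \<inter> P U"
    have W: "is_open Y W" "W \<subseteq> V" "W \<subseteq> P U" using V PU by (auto simp: W_def)
    \<comment> \<open>The regular functions \<open>s j (\<pi>\<^sup>*f k)\<close> of the outline,
      with \<open>f k\<close> the coordinate \<open>d k\<close> of \<open>\<sigma>\<close>, written
      in code as \<open>b k j\<close>.\<close>
    define b where "b k j = s j W (res Y (P U) W (pull \<pi> U (d k U (\<sigma>_on U))))" for k j
    have b: "b k j \<in> carrier (sec Y W)" if "k < m" "j < n" for k j
      unfolding b_def
      by (rule Y.L_closed[OF s W(1,2)]) (use that PU W Y.J_res pull_I U form_section_in_I d in auto)
    \<comment> \<open>The \<open>k\<close>-th coordinate of the transpose image of the combination
      of the \<open>s j\<close> with coefficients \<open>snd z\<close>.\<close>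
    define \<beta> where "\<beta> k z = (\<Sum>j<n. snd z j * snd (fst z) W (b k j))"
      for k and z :: "('q, 'b, 'f) geom_point \<times> (nat \<Rightarrow> 'f alg_closure)"
    let ?S = "subtopology ?Z (T U)"
    have \<beta>_cont: "continuous_map ?S (valued_field_topology v) (\<beta> k)" if k: "k < m" for k
      unfolding \<beta>_def
    proof (intro continuous_map_valued_field_sum[OF v] continuous_map_valued_field_mult[OF v])
      fix j assume "j \<in> {..<n}"
      then have j: "j \<in> {..<n}" "j < n" by auto
      have "continuous_map ?Z (valued_field_topology v) ((\<lambda>a. a j) \<circ> snd)"
        by (rule continuous_map_compose[OF snd_cont]) (rule continuous_map_product_projection[OF j(1)])
      then show "continuous_map ?S (valued_field_topology v) (\<lambda>z. snd z j)"
        by (simp add: continuous_map_from_subtopology o_def)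
      have "continuous_map ?S (analytic_topology v Y c\<^sub>Y) fst"
        using continuous_map_into_fulltopology[OF continuous_map_from_subtopology[OF fst_cont]] .
      moreover have "fst ` topspace ?S \<subseteq> {y. fst y \<in> W}"
        using Tmem by (auto simp: W_def)
      ultimately have "continuous_map ?S (subtopology (analytic_topology v Y c\<^sub>Y) {y. fst y \<in> W}) fst"
        by (auto simp: continuous_map_in_subtopology)
      from continuous_map_compose[OF this Y.continuous_map_ev[OF v W(1) b[OF k j(2)]]]
      show "continuous_map ?S (valued_field_topology v) (\<lambda>z. snd (fst z) W (b k j))"
        by (simp add: o_def)
    qed
    define h where "h z = (push (fst z), \<lambda>k\<in>{..<m}. \<beta> k z)" for z
    let ?AX = "subtopology (analytic_topology v \<XX> c) {p. fst p \<in> U}"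
    let ?BX = "product_topology (\<lambda>_. valued_field_topology v) {..<m}"
    let ?G = "\<lambda>(p, a). N p (fibre_class \<XX> E p (\<Sum>k<m. Poly_Mapping.single (U, e k) (a k)))"
    have "continuous_map ?S (analytic_topology v \<XX> c) (push \<circ> fst)"
      by (rule continuous_map_compose[OF _ continuous_map_push[OF v]])
        (rule continuous_map_into_fulltopology[OF continuous_map_from_subtopology[OF fst_cont]])
    moreover have "fst (push (fst z)) \<in> U" if "z \<in> T U" for z
      using Tmem(3)[OF that] by (simp add: preim_def)
    ultimately have "continuous_map ?S ?AX (\<lambda>z. push (fst z))"
      by (auto simp: continuous_map_in_subtopology o_def)
    moreover have "continuous_map ?S ?BX (\<lambda>z. \<lambda>k\<in>{..<m}. \<beta> k z)"
      using \<beta>_cont by (auto simp: continuous_map_componentwise)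
    ultimately have "continuous_map ?S (prod_topology ?AX ?BX) h"
      unfolding h_def by (simp add: continuous_map_paired)
    \<comment> \<open>Here the metric of \<open>E\<close> has to be continuous jointly in the point
      and the coefficients, because the coordinates vary with \<open>z\<close>.\<close>
    moreover have "continuous_map (prod_topology ?AX ?BX) euclideanreal ?G"
      using N U e unfolding metric_on_def by blast
    ultimately have "continuous_map ?S euclideanreal (?G \<circ> h)"
      by (rule continuous_map_compose)
    moreover have "(?G \<circ> h) z = ?F z" if "z \<in> topspace ?S" for z
    proof -
      from that have z: "z \<in> T U" by simp
      obtain y a where ya: "z = (y, a)" by (cases z)
      note mem = Tmem[OF z, unfolded ya fst_conv]
      interpret pulled_zero_section_point \<XX> E Y J \<pi> I \<sigma> c y by (rule point_locale) (rule mem)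
      let ?u = "\<Sum>j<n. Poly_Mapping.single (V, s j) (a j)"
      have u: "?u \<in> fsums Y Y.L y"
        by (intro fsums_sum fsums_single) (use V mem s in auto)
      have xU: "pmap \<pi> (fst y) \<in> U" using mem in_preim by simp
      have \<beta>: "divisor_pairing Y y (P U) (pull \<pi> U (d k U (\<sigma>_on U))) ?u = \<beta> k z" for k
        by (simp add: divisor_pairing_def lin_ext_sum \<beta>_def b_def W_def ya Let_def)
      have "?F z = N (push y) (fibre_class \<XX> E (push y) (\<Sum>k<m. Poly_Mapping.single (U, e k)
          (divisor_pairing Y y (P U) (pull \<pi> U (d k U (\<sigma>_on U))) ?u)))"
        using induced_metric_eq[OF mem(1) u transpose_of_frame[OF fr xU d dec u]] by (simp add: ya)
      then show ?thesis
        by (simp add: \<beta> h_def) (simp add: ya)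
    qed
    ultimately show "continuous_map (subtopology ?Z (case i of (U, m, e) \<Rightarrow> T U)) euclideanreal ?F"
      unfolding i prod.case by (rule continuous_map_eq)
  next
    fix z assume z: "z \<in> topspace ?Z"
    then have y: "fst z \<in> geom_points Y c\<^sub>Y" "fst (fst z) \<in> V" using topA by auto
    interpret pulled_zero_section_point \<XX> E Y J \<pi> I \<sigma> c "fst z" by (rule point_locale) (rule y)
    obtain U m e where "frame_on \<XX> E U m e" "pmap \<pi> (fst (fst z)) \<in> U"
      by (rule frame_exists) blast
    then have "z \<in> T U" "(U, m, e) \<in> {(U, m, e). frame_on \<XX> E U m e}"
      using z topA y in_preim by (auto simp: T_def)
    then show "\<exists>i. i \<in> {(U, m, e). frame_on \<XX> E U m e} \<and> z \<in> (case i of (U, m, e) \<Rightarrow> T U) \<and> ?F z = ?F z"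
      by blast
  qed simp
qed

lemma induced_metric_metric_on:
  assumes v: "absolute_value v" and N: "metric_on v \<XX> c E N"
  shows "metric_on v Y c\<^sub>Y Y.L (induced_metric N)"
  unfolding metric_on_def
proof (intro conjI allI impI ballI)
  show "induced_metric N \<in> extensional (geom_points Y c\<^sub>Y)"
    by (simp add: induced_metric_def)
  show "fibre_norm v Y Y.L y (induced_metric N y)" if "y \<in> geom_points Y c\<^sub>Y" for y
    by (rule induced_metric_fibre_norm[OF that])
      (use N push_geom_points[OF that] in \<open>simp add: metric_on_def\<close>)
qed (rule induced_metric_continuous[OF v N], auto)

text \<open>Every element of a fibre of \<open>O(D)\<close> has a transpose image, so isometry
  prescribes the norm on all fibres; extensionality settles the remaining arguments.\<close>

lemma induced_from_iff:
  assumes v: "absolute_value v" and N: "metric_on v \<XX> c E N"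
  shows "metric_on v Y c\<^sub>Y Y.L N' \<and> induced_from \<XX> c E \<sigma> N Y \<pi> J N' \<longleftrightarrow> N' = induced_metric N"
proof
  assume "N' = induced_metric N"
  then show "metric_on v Y c\<^sub>Y Y.L N' \<and> induced_from \<XX> c E \<sigma> N Y \<pi> J N'"
    using induced_metric_metric_on[OF v N] induced_metric_eq by (simp add: induced_from_def)
next
  assume *: "metric_on v Y c\<^sub>Y Y.L N' \<and> induced_from \<XX> c E \<sigma> N Y \<pi> J N'"
  show "N' = induced_metric N"
  proof (rule extensionalityI[of _ "geom_points Y c\<^sub>Y"])
    show "N' \<in> extensional (geom_points Y c\<^sub>Y)" "induced_metric N \<in> extensional (geom_points Y c\<^sub>Y)"
      using * induced_metric_metric_on[OF v N] by (simp_all add: metric_on_def)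
    fix y assume y: "y \<in> geom_points Y c\<^sub>Y"
    interpret pulled_zero_section_point \<XX> E Y J \<pi> I \<sigma> c y by (rule point_locale) fact
    show "N' y = induced_metric N y"
    proof (rule extensionalityI[of _ "fibre Y Y.L y"])
      show "N' y \<in> extensional (fibre Y Y.L y)" "induced_metric N y \<in> extensional (fibre Y Y.L y)"
        using * induced_metric_metric_on[OF v N] y by (simp_all add: metric_on_def fibre_norm_def)
      fix A assume "A \<in> fibre Y Y.L y"
      then obtain u where u: "u \<in> fsums Y Y.L y" "A = fibre_class Y Y.L y u"
        by (auto simp: fibre_def)
      obtain w where w: "w \<in> fsums \<XX> E (push y)" "transpose_maps_to \<XX> E \<sigma> Y \<pi> y u w"
        using transpose_exists[OF u(1)] .
      have "N' y A = N (push y) (fibre_class \<XX> E (push y) w)"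
        using * y u w unfolding induced_from_def by blast
      then show "N' y A = induced_metric N y A"
        using induced_metric_eq[OF y u(1) w] u(2) by simp
    qed
  qed
qed

text \<open>The inclusion of \<open>O(-D)\<close> leaves the pull-back of \<open>l(\<sigma>)\<close>
  unchanged, and its value at \<open>y\<close> is that of \<open>l(\<sigma>)\<close> at the image
  point. Thus the canonical section is sent to \<open>\<sigma>\<close> by the transpose, and
  isometry gives equal norms.\<close>

lemma induced_metric_canonical_section:
  assumes y: "y \<in> geom_points Y c\<^sub>Y"
  shows "induced_metric N y (value_at Y Y.L (pts Y) (canonical_section Y J) y)
    = N (push y) (value_at \<XX> E (pts \<XX>) \<sigma> (push y))"
  unfolding value_at_def
proof (rule induced_metric_eq[OF y])
  interpret pulled_zero_section_point \<XX> E Y J \<pi> I \<sigma> c y by (rule point_locale) fact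
  have q: "fst y \<in> pts Y"
    using y by (auto simp: geom_points_def)
  show "Poly_Mapping.single (pts Y, canonical_section Y J) 1 \<in> fsums Y Y.L y"
    by (rule fsums_single[OF openin_topspace q Y.canonical_section_closed])
  have "fst (push y) \<in> pts \<XX>"
    using q preim_pts by (auto simp: preim_def)
  then show "Poly_Mapping.single (pts \<XX>, \<sigma>) 1 \<in> fsums \<XX> E (push y)"
    by (rule fsums_single[OF openin_topspace _ section_closed])
  show "transpose_maps_to \<XX> E \<sigma> Y \<pi> y (Poly_Mapping.single (pts Y, canonical_section Y J) 1)
    (Poly_Mapping.single (pts \<XX>, \<sigma>) 1)"
    unfolding transpose_maps_to_iff
  proof (intro allI impI)
    fix U l assume *: "is_open \<XX> U \<and> pmap \<pi> (fst y) \<in> U \<and> l \<in> sheaf_forms \<XX> E U"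
    let ?s = "l U (\<sigma>_on U)"
    have PU: "is_open Y (P U)" using preim_open * by blast
    have j: "pull \<pi> U ?s \<in> J (P U)" and s: "?s \<in> carrier (sec \<XX> U)"
      using * form_section_in_I pull_I I_subset by auto
    have "pts Y \<inter> P U = P U" "pts \<XX> \<inter> U = U"
      using PU * openin_subset by blast+
    moreover have "res Y (P U) (P U) (pull \<pi> U ?s) = pull \<pi> U ?s"
      by (rule Y.res_id[OF PU]) (rule Y.J_subset[OF PU j])
    ultimately show "divisor_pairing Y y (P U) (pull \<pi> U ?s) (Poly_Mapping.single (pts Y, canonical_section Y J) 1)
      = form_value E (push y) U l (Poly_Mapping.single (pts \<XX>, \<sigma>) 1)"
      using * PU j s openin_subset[OF PU]
      by (simp add: divisor_pairing_def form_value_def canonical_section_def snd_push)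
  qed
qed

end

text \<open>The equivalence in the conclusion makes the word canonical precise: isometry of the
  transpose into the pull-back of \<open>E\<close> has exactly one solution among metrics on
  \<open>O(D)\<close>, so frames and local equations chosen in the proof do not affect it.\<close>

theorem mainTheorem2:
  fixes \<XX> :: "('p, 'a) ringed_space" and c :: "'f::field \<Rightarrow> 'a"
    and v :: "'f \<Rightarrow> real" and vbar :: "'f alg_closure \<Rightarrow> real"
    and I :: "'p set \<Rightarrow> 'a set"
    and Y :: "('q, 'b) ringed_space" and \<pi> :: "('q, 'b, 'p, 'a) morphism"
    and J :: "'q set \<Rightarrow> 'b set"
    and E :: "('p, 'a, 'm) module_sheaf" and \<sigma> :: 'm
    and N :: "('p, 'a, 'f) geom_point \<Rightarrow> ('p, 'm, 'f) fsum set \<Rightarrow> real"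
  assumes "absolute_value v"
    and "absolute_value vbar" and "\<And>a. vbar (to_ac a) = v a"
    and "variety \<XX> c"
    and "quasi_coherent_ideal \<XX> I"
    and "is_blow_up \<XX> I Y \<pi>"
    and "J = inverse_image_ideal \<XX> I Y \<pi>"
    and "locally_free_of_finite_rank \<XX> E"
    and "\<sigma> \<in> carrier (msec E (pts \<XX>))"
    and "\<And>U. is_open \<XX> U \<Longrightarrow> zero_scheme_ideal \<XX> E \<sigma> U = I U"
    and "metric_on vbar \<XX> c E N"
  shows "\<exists>N\<^sub>D.
    metric_on vbar Y (pulled_back_structure \<XX> c \<pi>) (line_sheaf_of_divisor Y J) N\<^sub>D \<and>
    (\<forall>N'. metric_on vbar Y (pulled_back_structure \<XX> c \<pi>) (line_sheaf_of_divisor Y J) N' \<and>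
      induced_from \<XX> c E \<sigma> N Y \<pi> J N' \<longleftrightarrow> N' = N\<^sub>D) \<and>
    (\<forall>y\<in>geom_points Y (pulled_back_structure \<XX> c \<pi>).
      N\<^sub>D y (value_at Y (line_sheaf_of_divisor Y J) (pts Y) (canonical_section Y J) y)
        = N (push_point \<XX> Y \<pi> y) (value_at \<XX> E (pts \<XX>) \<sigma> (push_point \<XX> Y \<pi> y)))"
proof -
  have X: "is_ringed_space \<XX>" "structure_map \<XX> c"
    using assms(4) by (simp_all add: variety_def scheme_def)
  have Y: "is_ringed_space Y" "is_morphism Y \<XX> \<pi>" "effective_cartier_ideal Y J"
    using assms(6,7) by (simp_all add: is_blow_up_def scheme_def)
  have I: "is_ideal_sheaf \<XX> I"
    using assms(5) by (simp add: quasi_coherent_ideal_def)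
  have E: "is_module_sheaf \<XX> E"
    using assms(8) by (simp add: locally_free_of_finite_rank_def)
  interpret pulled_zero_section \<XX> E Y J \<pi> I \<sigma> c
    by unfold_locales (fact X Y I E assms(7-10))+
  show ?thesis
  proof (rule exI[of _ "induced_metric N"], intro conjI allI ballI)
    show "metric_on vbar Y c\<^sub>Y Y.L (induced_metric N)"
      by (rule induced_metric_metric_on[OF assms(2,11)])
    show "metric_on vbar Y c\<^sub>Y Y.L N' \<and> induced_from \<XX> c E \<sigma> N Y \<pi> J N' \<longleftrightarrow> N' = induced_metric N" for N'
      by (rule induced_from_iff[OF assms(2,11)])
    show "induced_metric N y (value_at Y Y.L (pts Y) (canonical_section Y J) y)
        = N (push y) (value_at \<XX> E (pts \<XX>) \<sigma> (push y))" if "y \<in> geom_points Y c\<^sub>Y" for y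
      by (rule induced_metric_canonical_section[OF that])
  qed
qed

end
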